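(* There is a reduction algorithm such that the following holds. For any positive integer $\ell$, given as input a 3CNF formula $\varphi$ with $n$ variables and $m$ clauses, in which each variable is contained in at most four clauses and each clause contains exactly three distinct variables, the algorithm produces a Vector-Valued CSP instance $G=(V,E,\Sigma,\{\Pi_e\}_{e\in E})$ such that: (S1) $|V|=48\ell^2$ and $|E|=72\ell^2$; (S2) the reduction runs in time $\ell^{O(1)}\cdot 2^{O(n/\ell)}$; (S3) $\Sigma=\mathbb{F}_8^d$ where $d=\max\{\lceil m/\ell\rceil,\lceil n/\ell\rceil\}$; (S4) $G$ is satisfiable if and only if $\varphi$ is satisfiable.
   Context: A (binary) CSP instance $G=(V,E,\Sigma,\{\Pi_e\}_{e\in E})$ has variables $V$, constraints $E$ (multiple constraints on the same pair allowed), each $e$ relating two distinct variables $u_e,v_e$, alphabet $\Sigma$, and validity functions $\Pi_e:\Sigma\times\Sigma\to\{0,1\}$; $G$ is satisfiable if some assignment $\sigma:V\to\Sigma$ satisfies all constraints. A Vector-Valued CSP is a CSP instance with: (1) $\Sigma=\mathbb{F}^d$ for a finite field $\mathbb{F}$ of characteristic $2$; (2) each constraint $e=\{u,v\}$ is either linear, i.e. $\Pi_e(u,v)=\mathbb{1}_{u=M_ev}$ for some matrix $M_e\in\mathbb{F}^{d\times d}$, or parallel, i.e. there are a sub-constraint $\Pi^{sub}_e:\mathbb{F}\times\mathbb{F}\to\{0,1\}$ and a set $Q_e\subseteq[d]$ with $\Pi_e(u,v)=\bigwedge_{i\in Q_e}\Pi^{sub}_e(u_i,v_i)$ (a constraint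 that is both is classified as linear); (3) each variable is related to at most one parallel constraint. A variable is contained in a clause if it or its negation appears in the clause. *)

theory Defs
  imports Complex_Main "HOL-Computational_Algebra.Primes" "HOL-Library.Cardinality" "HOL-Library.Z2" "Jordan_Normal_Form.Matrix"
begin

section \<open>3CNF formulas\<close>

text \<open>A literal is a variable together with its sign (\<open>True\<close> for \<open>x\<close>, \<open>False\<close> for its negation).\<close>

type_synonym literal = "nat \<times> bool"
type_synonym clause = "literal list"
type_synonym cnf = "clause list"

definition clause_vars :: "clause \<Rightarrow> nat set" where
  "clause_vars c = fst ` set c"

text \<open>The variables of a formula with \<open>n\<close> variables are \<open>0, \<dots>, n - 1\<close>; they need not all occur.
  Clauses may be repeated, and repetitions count towards the four clauses allowed per variable.\<close>

definition bounded_3cnf :: "nat \<Rightarrow> cnf \<Rightarrow> bool" where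
  "bounded_3cnf n \<phi> \<longleftrightarrow>
     (\<forall>c\<in>set \<phi>. length c = 3 \<and> card (clause_vars c) = 3 \<and> clause_vars c \<subseteq> {..<n}) \<and>
     (\<forall>x<n. card {j. j < length \<phi> \<and> x \<in> clause_vars (\<phi> ! j)} \<le> 4)"

definition cnf_satisfiable :: "cnf \<Rightarrow> bool" where
  "cnf_satisfiable \<phi> \<longleftrightarrow> (\<exists>\<alpha> :: nat \<Rightarrow> bool. \<forall>c\<in>set \<phi>. \<exists>(x, s)\<in>set c. \<alpha> x = s)"


section \<open>Constraint satisfaction problems\<close>

text \<open>Constraints have names of their own, so that several of them may relate the same pair of
  variables.\<close>

record ('v, 'e, 's) csp =
  Vars :: "'v set"
  Cons :: "'e set"
  lend :: "'e \<Rightarrow> 'v"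
  rend :: "'e \<Rightarrow> 'v"
  Alph :: "'s set"
  Valid :: "'e \<Rightarrow> 's \<Rightarrow> 's \<Rightarrow> bool"

definition csp_instance :: "('v, 'e, 's) csp \<Rightarrow> bool" where
  "csp_instance G \<longleftrightarrow> finite (Vars G) \<and> finite (Cons G) \<and> finite (Alph G) \<and>
     (\<forall>e\<in>Cons G. lend G e \<in> Vars G \<and> rend G e \<in> Vars G \<and> lend G e \<noteq> rend G e)"

definition csp_satisfiable :: "('v, 'e, 's) csp \<Rightarrow> bool" where
  "csp_satisfiable G \<longleftrightarrow>
     (\<exists>\<sigma>. (\<forall>v\<in>Vars G. \<sigma> v \<in> Alph G) \<and> (\<forall>e\<in>Cons G. Valid G e (\<sigma> (lend G e)) (\<sigma> (rend G e))))"

definition linear_constraint :: "nat \<Rightarrow> ('f::field vec \<Rightarrow> 'f vec \<Rightarrow> bool) \<Rightarrow> bool" where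
  "linear_constraint d R \<longleftrightarrow>
     (\<exists>M\<in>carrier_mat d d. \<forall>u\<in>carrier_vec d. \<forall>v\<in>carrier_vec d. R u v \<longleftrightarrow> u = M *\<^sub>v v)"

definition parallel_constraint :: "nat \<Rightarrow> ('f::field vec \<Rightarrow> 'f vec \<Rightarrow> bool) \<Rightarrow> bool" where
  "parallel_constraint d R \<longleftrightarrow>
     (\<exists>(R_sub :: 'f \<Rightarrow> 'f \<Rightarrow> bool) Q. Q \<subseteq> {..<d} \<and>
       (\<forall>u\<in>carrier_vec d. \<forall>v\<in>carrier_vec d. R u v \<longleftrightarrow> (\<forall>i\<in>Q. R_sub (u $ i) (v $ i))))"

text \<open>A constraint that is both linear and parallel is classified as linear, so only the constraints
  that are not linear count in the last conjunct.\<close>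

definition vector_valued_csp :: "nat \<Rightarrow> ('v, 'e, 'f::{field, finite} vec) csp \<Rightarrow> bool" where
  "vector_valued_csp d G \<longleftrightarrow> csp_instance G \<and> CHAR('f) = 2 \<and> Alph G = carrier_vec d \<and>
     (\<forall>e\<in>Cons G. linear_constraint d (Valid G e) \<or> parallel_constraint d (Valid G e)) \<and>
     (\<forall>x\<in>Vars G. card {e\<in>Cons G. (lend G e = x \<or> rend G e = x) \<and>
        parallel_constraint d (Valid G e) \<and> \<not> linear_constraint d (Valid G e)} \<le> 1)"


section \<open>The field with eight elements\<close>

text \<open>\<open>GF8 a b c\<close> is the residue class of \<open>a + b X + c X\<^sup>2\<close> in \<open>GF(2)[X] / (X\<^sup>3 + X + 1)\<close>, where
  \<open>X\<^sup>3 = X + 1\<close> and \<open>X\<^sup>4 = X\<^sup>2 + X\<close>. The inverse of \<open>x\<close> is \<open>x\<^sup>6\<close>.\<close>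

datatype gf8 = GF8 bit bit bit

instantiation gf8 :: field
begin

definition zero_gf8 :: gf8 where "0 = GF8 0 0 0"
definition one_gf8 :: gf8 where "1 = GF8 1 0 0"
definition uminus_gf8 :: "gf8 \<Rightarrow> gf8" where "- x = (x :: gf8)"

fun plus_gf8 :: "gf8 \<Rightarrow> gf8 \<Rightarrow> gf8" where
  "GF8 a b c + GF8 a' b' c' = GF8 (a + a') (b + b') (c + c')"

definition minus_gf8 :: "gf8 \<Rightarrow> gf8 \<Rightarrow> gf8" where "x - y = x + (y :: gf8)"

fun times_gf8 :: "gf8 \<Rightarrow> gf8 \<Rightarrow> gf8" where
  "GF8 a b c * GF8 a' b' c' =
     GF8 (a * a' + (b * c' + c * b'))
         (a * b' + b * a' + (b * c' + c * b') + c * c')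
         (a * c' + b * b' + c * a' + c * c')"

definition inverse_gf8 :: "gf8 \<Rightarrow> gf8" where "inverse x = (x :: gf8) * x * (x * x) * (x * x)"
definition divide_gf8 :: "gf8 \<Rightarrow> gf8 \<Rightarrow> gf8" where "x div y = x * inverse (y :: gf8)"

instance
proof
  fix a b c :: gf8
  show "a * b * c = a * (b * c)"
    by (cases a; cases b; cases c) (simp del: mult_bit_eq_and add_bit_eq_xor add: algebra_simps)
  show "a * b = b * a"
    by (cases a; cases b) (simp del: mult_bit_eq_and add_bit_eq_xor add: algebra_simps)
  show "1 * a = a" by (cases a) (simp add: one_gf8_def)
  show "a + b + c = a + (b + c)"
    by (cases a; cases b; cases c) (simp del: mult_bit_eq_and add_bit_eq_xor add: algebra_simps)
  show "a + b = b + a"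
    by (cases a; cases b) (simp del: mult_bit_eq_and add_bit_eq_xor add: algebra_simps)
  show "0 + a = a" by (cases a) (simp add: zero_gf8_def)
  show "- a + a = 0" by (cases a) (simp add: zero_gf8_def uminus_gf8_def)
  show "a - b = a + - b" by (simp add: minus_gf8_def uminus_gf8_def)
  show "(a + b) * c = a * c + b * c"
    by (cases a; cases b; cases c) (simp del: mult_bit_eq_and add_bit_eq_xor add: algebra_simps)
  show "(0 :: gf8) \<noteq> 1" by (simp add: zero_gf8_def one_gf8_def)
  show "inverse a * a = 1" if "a \<noteq> 0"
  proof (cases a)
    case (GF8 x y z)
    then show ?thesis using that
      by (cases x; cases y; cases z) (simp_all add: inverse_gf8_def zero_gf8_def one_gf8_def)
  qed
  show "a div b = a * inverse b" by (simp add: divide_gf8_def)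
  show "inverse (0 :: gf8) = 0" by (simp add: inverse_gf8_def zero_gf8_def)
qed

end

definition gf8_list :: "gf8 list" where
  "gf8_list = [GF8 a b c. a \<leftarrow> [0, 1], b \<leftarrow> [0, 1], c \<leftarrow> [0, 1]]"

lemma UNIV_gf8: "UNIV = set gf8_list"
proof -
  have "x \<in> set gf8_list" for x
  proof (cases x)
    case (GF8 a b c)
    then show ?thesis by (cases a; cases b; cases c) (simp_all add: gf8_list_def)
  qed
  then show ?thesis by auto
qed

lemma distinct_gf8_list: "distinct gf8_list"
  by (simp add: gf8_list_def)

instance gf8 :: finite
  by standard (simp add: UNIV_gf8)

lemma CARD_gf8: "CARD(gf8) = 8"
  by (simp add: UNIV_gf8 distinct_card[OF distinct_gf8_list]) (simp add: gf8_list_def)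

lemma CHAR_gf8: "CHAR(gf8) = 2"
proof -
  have "of_nat 2 = (0 :: gf8)" by (simp add: numeral_2_eq_2 zero_gf8_def one_gf8_def)
  then have "CHAR(gf8) dvd 2" by (simp only: of_nat_eq_0_iff_char_dvd)
  moreover have "CHAR(gf8) \<noteq> 1" by (simp add: CHAR_not_1')
  ultimately show ?thesis
    by (metis prime_nat_iff two_is_prime_nat)
qed


section \<open>Algorithms and their running time\<close>

text \<open>
  Algorithms are programs of a first-order call-by-value language over binary trees, with mutually
  recursive functions. The running time is the number of evaluation steps, i.e. of nodes of the
  evaluation derivation (without list bookkeeping). A step only inspects or allocates one cell, or
  starts a call with the fixed number of arguments that the program text determines; hence, with
  trees stored as pointers, this cost measure agrees with the running time of Turing machines up to
  a polynomial, as long as the size of input and output is itself within that bound. The class of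
  time bounds \<open>l\<^bsup>O(1)\<^esup> 2\<^bsup>O(n/l)\<^esup>\<close> is closed under polynomials.

  Variables are de Bruijn indices into the environment; \<open>ECase e a b\<close> evaluates \<open>a\<close> if \<open>e\<close> is a leaf,
  and \<open>b\<close>, with the left and the right subtree pushed as variables 0 and 1, if it is a node.
  \<open>ECall f es\<close> runs the \<open>f\<close>-th function body with exactly the values of \<open>es\<close> as environment.
\<close>

datatype tree = Leaf | Node tree tree

datatype expr =
    EVar nat
  | ELeaf
  | ENode expr expr
  | ECase expr expr expr
  | ECall nat "expr list"

type_synonym program = "expr list"

inductive eval :: "program \<Rightarrow> tree list \<Rightarrow> expr \<Rightarrow> tree \<Rightarrow> nat \<Rightarrow> bool"
  and evals :: "program \<Rightarrow> tree list \<Rightarrow> expr list \<Rightarrow> tree list \<Rightarrow> nat \<Rightarrow> bool"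
  for P :: program where
  eval_var: "i < length env \<Longrightarrow> eval P env (EVar i) (env ! i) 1"
| eval_leaf: "eval P env ELeaf Leaf 1"
| eval_node: "eval P env e1 v1 t1 \<Longrightarrow> eval P env e2 v2 t2 \<Longrightarrow>
    eval P env (ENode e1 e2) (Node v1 v2) (t1 + t2 + 1)"
| eval_case_leaf: "eval P env e Leaf t1 \<Longrightarrow> eval P env a v t2 \<Longrightarrow>
    eval P env (ECase e a b) v (t1 + t2 + 1)"
| eval_case_node: "eval P env e (Node x y) t1 \<Longrightarrow> eval P (x # y # env) b v t2 \<Longrightarrow>
    eval P env (ECase e a b) v (t1 + t2 + 1)"
| eval_call: "f < length P \<Longrightarrow> evals P env es vs t1 \<Longrightarrow> eval P vs (P ! f) v t2 \<Longrightarrow>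
    eval P env (ECall f es) v (t1 + t2 + 1)"
| evals_Nil: "evals P env [] [] 0"
| evals_Cons: "eval P env e v t1 \<Longrightarrow> evals P env es vs t2 \<Longrightarrow>
    evals P env (e # es) (v # vs) (t1 + t2)"

inductive_cases eval_VarE: "eval P env (EVar i) v t"
inductive_cases eval_LeafE: "eval P env ELeaf v t"
inductive_cases eval_NodeE: "eval P env (ENode e1 e2) v t"
inductive_cases eval_CaseE: "eval P env (ECase e a b) v t"
inductive_cases eval_CallE: "eval P env (ECall f es) v t"
inductive_cases evals_NilE: "evals P env [] vs t"
inductive_cases evals_ConsE: "evals P env (e # es) vs t"

lemma eval_deterministic:
  "eval P env e v t \<Longrightarrow> eval P env e v' t' \<Longrightarrow> v = v' \<and> t = t'"
  "evals P env es vs t \<Longrightarrow> evals P env es vs' t' \<Longrightarrow> vs = vs' \<and> t = t'"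
proof (induction arbitrary: v' t' and vs' t' rule: eval_evals.inducts)
  case eval_var
  then show ?case by (auto elim: eval_VarE)
next
  case eval_leaf
  then show ?case by (auto elim: eval_LeafE)
next
  case eval_node
  from eval_node.prems show ?case by (rule eval_NodeE) (auto dest!: eval_node.IH(2) eval_node.IH(4))
next
  case eval_case_leaf
  from eval_case_leaf.prems show ?case
    by (rule eval_CaseE) (auto dest!: eval_case_leaf.IH(2) eval_case_leaf.IH(4))
next
  case eval_case_node
  from eval_case_node.prems show ?case
    by (rule eval_CaseE) (auto dest!: eval_case_node.IH(2) eval_case_node.IH(4))
next
  case eval_call
  from eval_call.prems show ?case by (rule eval_CallE) (auto dest!: eval_call.IH(3) eval_call.IH(5))
next
  case evals_Nil
  then show ?case by (auto elim: evals_NilE)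
next
  case evals_Cons
  from evals_Cons.prems show ?case by (rule evals_ConsE) (auto dest!: evals_Cons.IH(2) evals_Cons.IH(4))
qed

text \<open>Function 0 of a program is its entry point.\<close>

definition runs_on :: "program \<Rightarrow> tree \<Rightarrow> tree \<Rightarrow> nat \<Rightarrow> bool" where
  "runs_on P x y t \<longleftrightarrow> eval P [x] (ECall 0 [EVar 0]) y t"


section \<open>Encodings\<close>

text \<open>Natural numbers are written in unary: conversion from binary is polynomial in the value, so
  this does not affect a time bound that is polynomial in \<open>l\<close> and \<open>n\<close>.\<close>

fun enc_nat :: "nat \<Rightarrow> tree" where
  "enc_nat 0 = Leaf"
| "enc_nat (Suc k) = Node Leaf (enc_nat k)"

definition enc_bool :: "bool \<Rightarrow> tree" where
  "enc_bool b = (if b then Node Leaf Leaf else Leaf)"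

fun enc_list :: "('a \<Rightarrow> tree) \<Rightarrow> 'a list \<Rightarrow> tree" where
  "enc_list f [] = Leaf"
| "enc_list f (x # xs) = Node (f x) (enc_list f xs)"

definition enc_literal :: "literal \<Rightarrow> tree" where
  "enc_literal l = Node (enc_nat (fst l)) (enc_bool (snd l))"

definition enc_input :: "nat \<Rightarrow> nat \<Rightarrow> cnf \<Rightarrow> tree" where
  "enc_input l n \<phi> =
     Node (enc_nat l) (Node (enc_nat n) (enc_list (enc_list enc_literal) \<phi>))"

text \<open>All vectors of \<open>GF(8)\<^sup>d\<close>, in the order of \<^const>\<open>List.n_lists\<close> (the last coordinate is the most
  significant one).\<close>

definition gf8_vecs :: "nat \<Rightarrow> gf8 vec list" where
  "gf8_vecs d = map vec_of_list (List.n_lists d gf8_list)"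

lemma set_gf8_vecs: "set (gf8_vecs d) = carrier_vec d"
proof -
  have "v \<in> set (gf8_vecs d)" if "v \<in> carrier_vec d" for v
  proof -
    have "list_of_vec v \<in> set (List.n_lists d gf8_list)"
      using that by (auto simp: set_n_lists UNIV_gf8[symmetric])
    then show ?thesis unfolding gf8_vecs_def by (metis imageI list.set_map vec_list)
  qed
  moreover have "v \<in> carrier_vec d" if "v \<in> set (gf8_vecs d)" for v
  proof -
    from that obtain xs where "xs \<in> set (List.n_lists d gf8_list)" "v = vec_of_list xs"
      unfolding gf8_vecs_def set_map by blast
    then show ?thesis by (simp add: set_n_lists carrier_dim_vec)
  qed
  ultimately show ?thesis by blast
qed

text \<open>A validity function is given by its truth table, one row for each value of its first argument.\<close>

definition enc_table :: "nat \<Rightarrow> (gf8 vec \<Rightarrow> gf8 vec \<Rightarrow> bool) \<Rightarrow> tree" where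
  "enc_table d R = enc_list (\<lambda>u. enc_list (\<lambda>v. enc_bool (R u v)) (gf8_vecs d)) (gf8_vecs d)"

text \<open>A tree can describe an instance only if the variables and the constraints are initial segments
  of the natural numbers. It consists of the number of variables, the dimension \<open>d\<close> of the alphabet
  \<open>GF(8)\<^sup>d\<close>, and, for each constraint, its two variables and its truth table.\<close>

definition describes_csp :: "nat \<Rightarrow> tree \<Rightarrow> (nat, nat, gf8 vec) csp \<Rightarrow> bool" where
  "describes_csp d y G \<longleftrightarrow>
     Vars G = {..<card (Vars G)} \<and> Cons G = {..<card (Cons G)} \<and> Alph G = carrier_vec d \<and>
     y = Node (enc_nat (card (Vars G))) (Node (enc_nat d)
           (enc_list
             (\<lambda>e. Node (enc_nat (lend G e)) (Node (enc_nat (rend G e)) (enc_table d (Valid G e))))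
             [0..<card (Cons G)]))"

end

theory Submission
  imports Defs
begin

text \<open>
  Variables and clauses are cut into \<open>l\<close> blocks of size \<open>d\<close>. A vector \<open>x\<^sub>j\<close> holds the truth values of the
  variables in block \<open>j\<close>, and a vector \<open>y\<^sub>i\<close> holds, for each clause in block \<open>i\<close>, the truth values of its
  three literals as the three bits of an element of \<open>GF(8)\<close>. For blocks \<open>i\<close>, \<open>j\<close>, a position \<open>s < 3\<close>
  and a sign \<open>b\<close>, a linear constraint sets a vector \<open>z\<close> to a selection of coordinates of \<open>x\<^sub>j\<close>, such that
  its \<open>k\<close>-th coordinate is the variable at position \<open>s\<close> of the \<open>k\<close>-th clause whenever that variable lies
  in block \<open>j\<close>. On the clauses where this is the case and the literal has sign \<open>b\<close>, a parallel
  constraint between \<open>z\<close> and a private copy of \<open>y\<^sub>i\<close> says that the clause holds and that bit \<open>s\<close> is the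
  value of the literal. The copies keep the number of parallel constraints per variable at one.
  The truth tables have size \<open>64\<^sup>d\<close> and \<open>d \<le> 4 n / l + 1\<close>, because \<open>m \<le> 4 n\<close>.
\<close>

section \<open>Counting calls\<close>

fun esize :: "expr \<Rightarrow> nat" where
  "esize (EVar i) = 1"
| "esize ELeaf = 1"
| "esize (ENode a b) = esize a + esize b + 1"
| "esize (ECase e a b) = esize e + esize a + esize b + 1"
| "esize (ECall f es) = sum_list (map esize es) + 1"

text \<open>A uniform bound on the size of every body, so that charging it once per call pays for
  the body entered. The added 1 keeps it positive, as \<open>runs_on_prog\<close> requires.\<close>

definition call_cost :: "program \<Rightarrow> nat" where
  "call_cost P = sum_list (map esize P) + 1"

text \<open>Inside one function body every node is evaluated at most once, so that it suffices to count the
  calls, whose number is at most \<open>c\<close>.\<close>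

definition ev :: "program \<Rightarrow> tree list \<Rightarrow> expr \<Rightarrow> tree \<Rightarrow> nat \<Rightarrow> bool" where
  "ev P env e v c \<longleftrightarrow> (\<exists>t. eval P env e v t \<and> t \<le> esize e + c * call_cost P)"

definition evl :: "program \<Rightarrow> tree list \<Rightarrow> expr list \<Rightarrow> tree list \<Rightarrow> nat \<Rightarrow> bool" where
  "evl P env es vs c \<longleftrightarrow> (\<exists>t. evals P env es vs t \<and> t
      \<le> sum_list (map esize es) + c * call_cost P)"

text \<open>The count of the body alone; the call that enters it is charged in
  \<open>ev_call\<close>.\<close>

definition fn :: "program \<Rightarrow> nat \<Rightarrow> tree list \<Rightarrow> tree \<Rightarrow> nat \<Rightarrow> bool" where
  "fn P f vs v c \<longleftrightarrow> f < length P \<and> ev P vs (P ! f) v c"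

text \<open>Applied first in the proofs below: it leaves the count as a schematic variable that the
  evaluation rules build up, and the comparison with the claimed count comes last.\<close>

lemma ev_mono: "ev P env e v c \<Longrightarrow> c \<le> c' \<Longrightarrow> ev P env e v c'"
  unfolding ev_def by (meson add_left_mono le_trans mult_le_mono1)

lemma fn_mono: "fn P f vs v c \<Longrightarrow> c \<le> c' \<Longrightarrow> fn P f vs v c'"
  unfolding fn_def by (blast intro: ev_mono)

lemma ev_var: "i < length env \<Longrightarrow> env ! i = v \<Longrightarrow> ev P env (EVar i) v 0"
  unfolding ev_def by (auto intro!: exI[of _ 1] eval_var)

lemma ev_leaf: "ev P env ELeaf Leaf 0"
  unfolding ev_def by (auto intro!: exI[of _ 1] eval_leaf)

lemma ev_node:
  assumes "ev P env a v c" "ev P env b w c'"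
  shows "ev P env (ENode a b) (Node v w) (c + c')"
proof -
  from assms obtain t t' where *: "eval P env a v t" "t \<le> esize a + c * call_cost P"
    "eval P env b w t'" "t' \<le> esize b + c' * call_cost P" unfolding ev_def by blast
  show ?thesis unfolding ev_def
    by (rule exI, rule conjI, rule eval_node[OF *(1,3)])
        (use * in \<open>simp add: algebra_simps\<close>)
qed

text \<open>The case distinction on \<open>w\<close> sits inside the premise, so that simplification
  picks the branch as soon as the constructor of \<open>w\<close> is known.\<close>

lemma ev_case:
  assumes "ev P env e w c"
    and "case w of Leaf \<Rightarrow> ev P env a v c' | Node x y \<Rightarrow> ev P (x # y # env) b v c'"
  shows "ev P env (ECase e a b) v (c + c')"
proof (cases w)
  case Leaf
  with assms obtain t t' where *: "eval P env e Leaf t" "t \<le> esize e + c * call_cost P"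
    "eval P env a v t'" "t' \<le> esize a + c' * call_cost P" unfolding ev_def by auto
  show ?thesis unfolding ev_def
    by (rule exI, rule conjI, rule eval_case_leaf[OF *(1,3)])
        (use * in \<open>simp add: algebra_simps\<close>)
next
  case (Node x y)
  with assms obtain t t' where *: "eval P env e (Node x y) t" "t \<le> esize e + c * call_cost P"
    "eval P (x # y # env) b v t'" "t' \<le> esize b + c' * call_cost P" unfolding ev_def by auto
  show ?thesis unfolding ev_def
    by (rule exI, rule conjI, rule eval_case_node[OF *(1,3)])
        (use * in \<open>simp add: algebra_simps\<close>)
qed

lemma ev_case_var:
  assumes "i < length env"
    and "case env ! i of Leaf \<Rightarrow> ev P env a v c | Node x y \<Rightarrow> ev P (x # y # env) b v c"
  shows "ev P env (ECase (EVar i) a b) v c"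
  using ev_case[OF ev_var[OF assms(1) refl] assms(2)] by simp

lemma evl_Nil: "evl P env [] [] 0"
  unfolding evl_def by (auto intro: evals_Nil)

lemma evl_Cons:
  assumes "ev P env e v c" "evl P env es vs c'"
  shows "evl P env (e # es) (v # vs) (c + c')"
proof -
  from assms obtain t t' where *: "eval P env e v t" "t \<le> esize e + c * call_cost P"
    "evals P env es vs t'" "t' \<le> sum_list (map esize es) + c' * call_cost P"
    unfolding ev_def evl_def by blast
  show ?thesis unfolding evl_def
    by (rule exI, rule conjI, rule evals_Cons[OF *(1,3)])
        (use * in \<open>simp add: algebra_simps\<close>)
qed

lemma ev_call:
  assumes "fn P f vs v c" "evl P env es vs c'"
  shows "ev P env (ECall f es) v (c + c' + 1)"
proof -
  from assms obtain t t' where *: "eval P vs (P ! f) v t" "t \<le> esize (P ! f) + c * call_cost P"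
    "evals P env es vs t'" "t' \<le> sum_list (map esize es) + c' * call_cost P" and f: "f < length P"
    unfolding ev_def evl_def fn_def by blast
  have "esize (P ! f) \<le> sum_list (map esize P)"
    using f by (intro member_le_sum_list) auto
  then have "esize (P ! f) + 1 \<le> call_cost P" by (simp add: call_cost_def)
  with * show ?thesis unfolding ev_def
    by - (rule exI, rule conjI, rule eval_call[OF f *(3,1)], simp add: algebra_simps)
qed

text \<open>Constants are spelled out in the program text; building them is paid for by
  \<open>esize\<close>, hence the zero count in \<open>ev_quote\<close>.\<close>

fun quote :: "tree \<Rightarrow> expr" where
  "quote Leaf = ELeaf"
| "quote (Node a b) = ENode (quote a) (quote b)"

lemma ev_quote: "ev P env (quote t) t 0"
proof (induction t)
  case (Node a b)
  then show ?case using ev_node[OF Node] by simp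
qed (simp add: ev_leaf)

lemma ev_case_call:
  assumes "fn P f vs w c" "evl P env es vs c'"
    and "case w of Leaf \<Rightarrow> ev P env a v c'' | Node x y \<Rightarrow> ev P (x # y # env) b v c''"
  shows "ev P env (ECase (ECall f es) a b) v (c + c' + 1 + c'')"
  by (rule ev_case[OF ev_call[OF assms(1,2)] assms(3)])

text \<open>Loops over the fixed lists \<open>gf8_list\<close> and \<open>kinds\<close> are unrolled
  in the program text; this evaluates such an unrolled loop in front of a list \<open>ys\<close>
  computed by \<open>e\<close>.\<close>

lemma ev_foldr:
  assumes "\<And>x. x \<in> set xs \<Longrightarrow> ev P env (b x) (f (g x)) c" "ev P env e (enc_list f ys) c'"
  shows "ev P env (foldr (\<lambda>x. ENode (b x)) xs e) (enc_list f (map g xs @ ys))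
      (length xs * c + c')"
  using assms
proof (induction xs)
  case (Cons x xs)
  then show ?case using ev_node[OF Cons.prems(1)[of x] Cons.IH] by (simp add: add.assoc)
qed simp

lemmas ev_rules = ev_leaf ev_node ev_case_var evl_Nil evl_Cons ev_var ev_quote

section \<open>The program\<close>

definition "f_main = (0 :: nat)"
definition "f_drop = (1 :: nat)"
definition "f_add = (2 :: nat)"
definition "f_mul = (3 :: nat)"
definition "f_cdiv = (4 :: nat)"
definition "f_ext = (5 :: nat)"
definition "f_nl = (6 :: nat)"
definition "f_pos = (7 :: nat)"
definition "f_ent = (8 :: nat)"
definition "f_locs = (9 :: nat)"
definition "f_par = (10 :: nat)"
definition "f_lin = (11 :: nat)"
definition "f_nth = (12 :: nat)"
definition "f_chk = (13 :: nat)"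
definition "f_row = (14 :: nat)"
definition "f_tab = (15 :: nat)"
definition "f_cells = (16 :: nat)"
definition "f_rows = (17 :: nat)"
definition "f_out = (18 :: nat)"

text \<open>The position in \<open>gf8_list\<close>, where the last coefficient varies
  fastest.\<close>

fun gidx :: "gf8 \<Rightarrow> nat" where
  "gidx (GF8 a b c) = (if a = 0 then 0 else 4) + (if b = 0 then 0 else 2) + (if c = 0 then 0 else 1)"

definition enc_gf8 :: "gf8 \<Rightarrow> tree" where
  "enc_gf8 x = enc_nat (gidx x)"

lemma gidx_less: "gidx x < 8"
  by (cases x) simp

lemma nth_gf8_list: "gf8_list ! gidx x = x"
proof (cases x)
  case (GF8 a b c)
  then show ?thesis by (cases a; cases b; cases c) (simp_all add: gf8_list_def)
qed

lemma length_gf8_list: "length gf8_list = 8"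
  by (simp add: gf8_list_def)

definition enc_rel :: "(gf8 \<Rightarrow> gf8 \<Rightarrow> bool) \<Rightarrow> tree" where
  "enc_rel R = enc_list (\<lambda>y. enc_list (\<lambda>z. enc_bool (R y z)) gf8_list) gf8_list"

section \<open>Constraints, their variables and their coordinate lists\<close>

text \<open>A constraint is given by the block \<open>i\<close> of clauses, the block \<open>j\<close> of variables, and a kind
  \<open>(t, s, b)\<close> that selects the literals of sign \<open>b\<close> at position \<open>s\<close> of their clause. The types are
  \<open>t = 0\<close> (parallel, between \<open>z\<close> and the copy of \<open>y\<^sub>i\<close>), \<open>t = 1\<close> (linear, between \<open>z\<close> and \<open>x\<^sub>j\<close>) and
  \<open>t \<ge> 2\<close> (equality of \<open>y\<^sub>i\<close> and its copy, repeated ten times in order to reach \<open>72 l\<^sup>2\<close> constraints).\<close>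

type_synonym kind = "nat \<times> nat \<times> bool"
type_synonym con = "(nat \<times> nat) \<times> kind"

definition kinds :: "kind list" where
  "kinds = List.product [0..<12] (List.product [0..<3] [False, True])"

text \<open>The variables \<open>name l q i j\<close> are \<open>z\<close> for \<open>q < 6\<close>, the copies of \<open>y\<^sub>i\<close> for \<open>6 \<le> q < 12\<close>, \<open>x\<^sub>j\<close> for
  \<open>q = 12\<close> and \<open>i = 0\<close>, and \<open>y\<^sub>i\<close> for \<open>q = 13\<close> and \<open>j = 0\<close>. All others with \<open>q < 48\<close> are idle.\<close>

definition name :: "nat \<Rightarrow> nat \<Rightarrow> nat \<Rightarrow> nat \<Rightarrow> nat" where
  "name l q i j = (q * l + i) * l + j"

definition slot :: "nat \<Rightarrow> bool \<Rightarrow> nat" where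
  "slot s b = 2 * s + of_bool b"

fun lvar :: "nat \<Rightarrow> con \<Rightarrow> nat" where
  "lvar l ((i, j), (t, s, b)) = name l (if t = 1 then slot s b else 6 + slot s b) i j"

fun rvar :: "nat \<Rightarrow> con \<Rightarrow> nat" where
  "rvar l ((i, j), (t, s, b)) =
     (if t = 0 then name l (slot s b) i j else if t = 1 then name l 12 0 j else name l 13 i 0)"

fun gf8_bit :: "nat \<Rightarrow> gf8 \<Rightarrow> bool" where
  "gf8_bit s (GF8 a b c) = ([a, b, c] ! s \<noteq> 0)"

text \<open>The bits of \<open>y\<close> are the truth values of the three literals, so
  \<open>y \<noteq> 0\<close> says that the clause holds; any nonzero \<open>z\<close> codes a true
  variable.\<close>

definition lit_rel :: "nat \<Rightarrow> bool \<Rightarrow> gf8 \<Rightarrow> gf8 \<Rightarrow> bool" where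
  "lit_rel s b y z \<longleftrightarrow> y \<noteq> 0 \<and> (gf8_bit s y \<longleftrightarrow> (z \<noteq> 0) = b)"

fun rel :: "kind \<Rightarrow> gf8 \<Rightarrow> gf8 \<Rightarrow> bool" where
  "rel (t, s, b) = (if t = 0 then lit_rel s b else (=))"

text \<open>Each constraint is stored as a list with one number per coordinate of its left variable: \<open>0\<close> if
  that coordinate is unconstrained, and \<open>Suc p\<close> if it is related to coordinate \<open>p\<close> of the right
  variable.\<close>

definition pos :: "nat \<Rightarrow> nat \<Rightarrow> nat \<Rightarrow> nat" where
  "pos v a d = (if a \<le> v \<and> v - a < d then Suc (v - a) else 0)"

definition entry :: "clause \<Rightarrow> nat \<Rightarrow> nat \<Rightarrow> nat \<Rightarrow> bool \<Rightarrow> nat" where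
  "entry c a d s b = (if s < length c \<and> snd (c ! s) = b then pos (fst (c ! s)) a d else 0)"

text \<open>The default 0 pads a block that extends past the last clause with unconstrained
  coordinates.\<close>

fun locs :: "nat \<Rightarrow> cnf \<Rightarrow> nat \<Rightarrow> nat \<Rightarrow> nat \<Rightarrow> bool \<Rightarrow> nat list" where
  "locs 0 cs a d s b = []"
| "locs (Suc r) cs a d s b =
     (case cs of [] \<Rightarrow> 0 | c # _ \<Rightarrow> entry c a d s b) # locs r (tl cs) a d s b"

text \<open>Keeps which coordinates are constrained but ties each to the coordinate of the same
  index, the shape of a parallel constraint.\<close>

fun diag :: "nat list \<Rightarrow> nat \<Rightarrow> nat list" where
  "diag [] k = []"
| "diag (e # es) k = (if e = 0 then 0 else Suc k) # diag es (Suc k)"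

text \<open>A linear constraint determines every coordinate; those without a matching literal may be tied to
  coordinate \<open>0\<close>.\<close>

definition filled :: "nat list \<Rightarrow> nat list" where
  "filled = map (\<lambda>e. Suc (e - 1))"

text \<open>For \<open>t \<ge> 2\<close> no entry of \<open>filled L\<close> is 0, so
  \<open>diag\<close> turns it into the identity on all coordinates.\<close>

fun coords :: "nat \<Rightarrow> cnf \<Rightarrow> con \<Rightarrow> nat list" where
  "coords d \<phi> ((i, j), (t, s, b)) =
     (let L = locs d (drop (i * d) \<phi>) (j * d) d s b
      in if t = 0 then diag L 0 else if t = 1 then filled L else diag (filled L) 0)"

definition sat_coords :: "(gf8 \<Rightarrow> gf8 \<Rightarrow> bool) \<Rightarrow> nat list \<Rightarrow> gf8 list \<Rightarrow> gf8 list \<Rightarrow> bool" where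
  "sat_coords R es us vs \<longleftrightarrow> (\<forall>k<length es. es ! k \<noteq> 0 \<longrightarrow> R (us ! k) (vs ! (es ! k - 1)))"

section \<open>Function bodies\<close>

definition b_drop :: expr where
  "b_drop = ECase (EVar 1) (EVar 0) (ECase (EVar 2) ELeaf (ECall f_drop [EVar 1, EVar 3]))"
definition b_add :: expr where
  "b_add = ECase (EVar 0) (EVar 1) (ENode ELeaf (ECall f_add [EVar 1, EVar 3]))"
definition b_mul :: expr where
  "b_mul = ECase (EVar 0) ELeaf (ECall f_add [EVar 3, ECall f_mul [EVar 1, EVar 3]])"
definition b_cdiv :: expr where
  "b_cdiv = ECase (EVar 0) ELeaf
     (ENode ELeaf (ECall f_cdiv [ECall f_drop [EVar 2, EVar 3], EVar 3]))"
definition b_ext :: expr where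
  "b_ext = ECase (EVar 0) ELeaf
     (foldr (\<lambda>g e. ENode (ENode (quote (enc_gf8 g)) (EVar 0)) e) gf8_list (ECall f_ext [EVar 1]))"
definition b_nl :: expr where
  "b_nl = ECase (EVar 0) (ENode ELeaf ELeaf) (ECall f_ext [ECall f_nl [EVar 1]])"
text \<open>Subtracting \<open>a\<close> from \<open>Suc v\<close> decides \<open>a \<le> v\<close>
  and leaves \<open>v - a\<close> as tail; subtracting that from \<open>d\<close> decides
  \<open>v - a < d\<close>.\<close>

definition b_pos :: expr where
  "b_pos = ECase (ECall f_drop [ENode ELeaf (EVar 0), EVar 1]) ELeaf
     (ECase (ECall f_drop [EVar 4, EVar 1]) ELeaf (ENode ELeaf (EVar 3)))"
definition b_ent :: expr where
  "b_ent = ECase (ECall f_drop [EVar 0, EVar 3]) ELeaf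
     (ECase (EVar 0) ELeaf
       (ECase (EVar 8)
         (ECase (EVar 1) (ECall f_pos [EVar 0, EVar 5, EVar 6]) ELeaf)
         (ECase (EVar 3) ELeaf (ECall f_pos [EVar 4, EVar 9, EVar 10]))))"
definition b_locs :: expr where
  "b_locs = ECase (EVar 0) ELeaf
     (ENode (ECase (EVar 3) ELeaf (ECall f_ent [EVar 0, EVar 6, EVar 7, EVar 8, EVar 9]))
       (ECall f_locs [EVar 1, ECase (EVar 3) ELeaf (EVar 1), EVar 4, EVar 5, EVar 6, EVar 7]))"
definition b_par :: expr where
  "b_par = ECase (EVar 0) ELeaf
     (ENode (ECase (EVar 0) ELeaf (ENode ELeaf (EVar 5)))
       (ECall f_par [EVar 1, ENode ELeaf (EVar 3)]))"
definition b_lin :: expr where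
  "b_lin = ECase (EVar 0) ELeaf
     (ENode (ECase (EVar 0) (ENode ELeaf ELeaf) (EVar 2)) (ECall f_lin [EVar 1]))"
definition b_nth :: expr where
  "b_nth = ECase (ECall f_drop [EVar 0, EVar 1]) ELeaf (EVar 0)"
definition b_chk :: expr where
  "b_chk = ECase (EVar 0) (ENode ELeaf ELeaf)
     (ECase (EVar 3) ELeaf
       (ECase (EVar 2) (ECall f_chk [EVar 3, EVar 1, EVar 6, EVar 7])
         (ECase (ECall f_nth [ECall f_nth [EVar 9, EVar 2], ECall f_nth [EVar 8, EVar 1]]) ELeaf
           (ECall f_chk [EVar 7, EVar 5, EVar 10, EVar 11]))))"
definition b_row :: expr where
  "b_row = ECase (EVar 0) ELeaf
     (ENode (ECall f_chk [EVar 4, EVar 3, EVar 0, EVar 5])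
       (ECall f_row [EVar 1, EVar 3, EVar 4, EVar 5]))"
definition b_tab :: expr where
  "b_tab = ECase (EVar 0) ELeaf
     (ENode (ECall f_row [EVar 3, EVar 0, EVar 4, EVar 5])
       (ECall f_tab [EVar 1, EVar 3, EVar 4, EVar 5]))"

text \<open>These expressions are evaluated in the environment of the inner loop: 1 is \<open>j\<close>, 3 is \<open>i\<close>, 4 is \<open>l\<close>,
  5 is \<open>d\<close>, 6 is the formula, and 7 is the list of all vectors.\<close>

definition e_name :: "nat \<Rightarrow> expr \<Rightarrow> expr \<Rightarrow> expr" where
  "e_name q i j = ECall f_add [ECall f_mul [ECall f_add [ECall f_mul [quote (enc_nat q), EVar 4], i],
     EVar 4], j]"
definition e_locs :: "nat \<Rightarrow> bool \<Rightarrow> expr" where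
  "e_locs s b = ECall f_locs [EVar 5, ECall f_drop [EVar 6, ECall f_mul [EVar 3, EVar 5]],
     ECall f_mul [EVar 1, EVar 5], EVar 5, quote (enc_nat s), quote (enc_bool b)]"
definition e_coords :: "kind \<Rightarrow> expr" where
  "e_coords k = (case k of (t, s, b) \<Rightarrow>
     if t = 0 then ECall f_par [e_locs s b, ELeaf]
     else if t = 1 then ECall f_lin [e_locs s b]
     else ECall f_par [ECall f_lin [e_locs s b], ELeaf])"
fun e_con :: "kind \<Rightarrow> expr" where
  "e_con (t, s, b) =
     ENode (e_name (if t = 1 then slot s b else 6 + slot s b) (EVar 3) (EVar 1))
       (ENode
         (if t = 0 then e_name (slot s b) (EVar 3) (EVar 1)
          else if t = 1 then e_name 12 ELeaf (EVar 1) else e_name 13 (EVar 3) ELeaf)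
         (ECall f_tab [EVar 7, EVar 7, e_coords (t, s, b), quote (enc_rel (rel (t, s, b)))]))"
text \<open>The last argument is the list that follows the emitted constraints, so rows are
  concatenated without an append function.\<close>

definition b_cells :: expr where
  "b_cells = ECase (EVar 0) (EVar 6)
     (foldr (\<lambda>k e. ENode (e_con k) e) kinds
       (ECall f_cells [EVar 1, EVar 3, EVar 4, EVar 5, EVar 6, EVar 7, EVar 8]))"
definition b_rows :: expr where
  "b_rows = ECase (EVar 0) ELeaf
     (ECall f_cells [EVar 3, EVar 1, EVar 3, EVar 4, EVar 5, EVar 6,
       ECall f_rows [EVar 1, EVar 3, EVar 4, EVar 5, EVar 6]])"
definition b_out :: expr where
  "b_out = ENode (ECall f_mul [quote (enc_nat 48), ECall f_mul [EVar 0, EVar 0]])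
     (ENode (EVar 2) (ECall f_rows [EVar 0, EVar 0, EVar 2, EVar 1, ECall f_nl [EVar 2]]))"
text \<open>The maximum of the two quotients is computed as \<open>a + (b - a)\<close> with
  truncated subtraction.\<close>

definition b_main :: expr where
  "b_main = ECase (EVar 0) ELeaf (ECase (EVar 1) ELeaf
     (ECall f_out [EVar 2, EVar 1, ECall f_add [ECall f_cdiv [EVar 1, EVar 2],
       ECall f_drop [ECall f_cdiv [EVar 0, EVar 2], ECall f_cdiv [EVar 1, EVar 2]]]]))"

definition prog :: program where
  "prog = [b_main, b_drop, b_add, b_mul, b_cdiv, b_ext, b_nl, b_pos, b_ent, b_locs, b_par, b_lin,
     b_nth, b_chk, b_row, b_tab, b_cells, b_rows, b_out]"

lemma fn_prog:
  "fn prog f_drop = (\<lambda>vs. ev prog vs b_drop)"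
  "fn prog f_add = (\<lambda>vs. ev prog vs b_add)"
  "fn prog f_mul = (\<lambda>vs. ev prog vs b_mul)"
  "fn prog f_cdiv = (\<lambda>vs. ev prog vs b_cdiv)"
  "fn prog f_ext = (\<lambda>vs. ev prog vs b_ext)"
  "fn prog f_nl = (\<lambda>vs. ev prog vs b_nl)"
  "fn prog f_pos = (\<lambda>vs. ev prog vs b_pos)"
  "fn prog f_ent = (\<lambda>vs. ev prog vs b_ent)"
  "fn prog f_locs = (\<lambda>vs. ev prog vs b_locs)"
  "fn prog f_par = (\<lambda>vs. ev prog vs b_par)"
  "fn prog f_lin = (\<lambda>vs. ev prog vs b_lin)"
  "fn prog f_nth = (\<lambda>vs. ev prog vs b_nth)"
  "fn prog f_chk = (\<lambda>vs. ev prog vs b_chk)"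
  "fn prog f_row = (\<lambda>vs. ev prog vs b_row)"
  "fn prog f_tab = (\<lambda>vs. ev prog vs b_tab)"
  "fn prog f_cells = (\<lambda>vs. ev prog vs b_cells)"
  "fn prog f_rows = (\<lambda>vs. ev prog vs b_rows)"
  "fn prog f_out = (\<lambda>vs. ev prog vs b_out)"
  "fn prog f_main = (\<lambda>vs. ev prog vs b_main)"
  by (simp_all add: fun_eq_iff fn_def prog_def f_drop_def f_add_def f_mul_def f_cdiv_def f_ext_def
      f_nl_def f_pos_def f_ent_def f_locs_def f_par_def f_lin_def f_nth_def f_chk_def f_row_def
      f_tab_def f_cells_def f_rows_def f_out_def f_main_def)

section \<open>Correctness and running time of the program\<close>

lemma fn_drop: "fn prog f_drop [enc_list f xs, enc_nat n] (enc_list f (drop n xs)) n"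
proof (induction n arbitrary: xs)
  case 0
  show ?case unfolding fn_prog b_drop_def by (rule ev_mono, (rule ev_rules | simp)+)
next
  case (Suc n)
  show ?case
  proof (cases xs)
    case Nil
    then show ?thesis
      unfolding fn_prog b_drop_def by - (rule ev_mono, (rule ev_rules | simp)+)
  next
    case (Cons y ys)
    then show ?thesis unfolding fn_prog b_drop_def
      by - (rule ev_mono, (rule ev_rules ev_call[OF Suc[of ys]] | simp)+)
  qed
qed

text \<open>A unary number is a list of leaves, so \<open>f_drop\<close> also subtracts and
  \<open>f_cdiv\<close> divides numbers as well as list lengths.\<close>

lemma enc_nat_eq: "enc_nat n = enc_list (\<lambda>_. Leaf) (replicate n ())"
  by (induction n) simp_all

lemma fn_drop_nat: "fn prog f_drop [enc_nat k, enc_nat n] (enc_nat (k - n)) n"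
  using fn_drop[of "\<lambda>_. Leaf" "replicate k ()" n] by (simp add: enc_nat_eq)

lemma fn_add: "fn prog f_add [enc_nat a, enc_nat b] (enc_nat (a + b)) a"
proof (induction a)
  case 0
  show ?case unfolding fn_prog b_add_def by (rule ev_mono, (rule ev_rules | simp)+)
next
  case (Suc a)
  show ?case
    unfolding fn_prog b_add_def by (rule ev_mono, (rule ev_rules ev_call[OF Suc] | simp)+)
qed

lemma fn_mul: "fn prog f_mul [enc_nat a, enc_nat b] (enc_nat (a * b)) (a * (b + 2))"
proof (induction a)
  case 0
  show ?case unfolding fn_prog b_mul_def by (rule ev_mono, (rule ev_rules | simp)+)
next
  case (Suc a)
  show ?case
    unfolding fn_prog b_mul_def
    by (rule ev_mono, (rule ev_rules ev_call[OF Suc] ev_call[OF fn_add[of b "a * b"]] | simp)+)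
qed

function cdiv :: "nat \<Rightarrow> nat \<Rightarrow> nat" where
  "cdiv n l = (if n = 0 \<or> l = 0 then 0 else Suc (cdiv (n - l) l))"
  by auto
termination by (relation "measure fst") auto

declare cdiv.simps [simp del]

lemma fn_cdiv:
  assumes "0 < l"
  shows "fn prog f_cdiv [enc_list f xs, enc_nat l] (enc_nat (cdiv (length xs) l)) (length xs * (l + 2))"
proof (induction "length xs" arbitrary: xs rule: less_induct)
  case less
  show ?case
  proof (cases xs)
    case Nil
    then show ?thesis
      unfolding fn_prog b_cdiv_def cdiv.simps[of "length xs"]
      by - (rule ev_mono, (rule ev_rules | simp)+)
  next
    case (Cons y ys)
    have "length (drop l xs) < length xs" using Cons assms by simp
    note IH = less[OF this, unfolded length_drop]
    \<comment> \<open>One round costs \<open>l + 2\<close> calls and, as \<open>0 < l\<close>,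
      removes at least one element.\<close>
    have "Suc (length xs - l) * (l + 2) \<le> length xs * (l + 2)"
      by (rule mult_le_mono1) (use Cons assms in simp)
    \<comment> \<open>Only the outermost constructor is exposed: the call of \<open>f_drop\<close>
      still needs \<open>enc_list f xs\<close> in one piece.\<close>
    moreover obtain a b where E: "enc_list f xs = Node a b" using Cons by simp
    moreover have "length xs \<noteq> 0" using Cons by simp
    ultimately show ?thesis
      using assms unfolding fn_prog b_cdiv_def cdiv.simps[of "length xs"]
      by - (rule ev_mono, (rule ev_rules ev_call[OF IH] ev_call[OF fn_drop[of f xs l]]
        | simp add: E)+)
  qed
qed

lemma fn_ext: "fn prog f_ext [enc_list (enc_list enc_gf8) xs]
   (enc_list (enc_list enc_gf8) (concat (map (\<lambda>ys. map (\<lambda>y. y # ys) gf8_list) xs))) (length xs)"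
proof (induction xs)
  case Nil
  show ?case unfolding fn_prog b_ext_def by (rule ev_mono, (rule ev_rules | simp)+)
next
  case (Cons x xs)
  show ?case
    unfolding fn_prog b_ext_def
    by (rule ev_mono, rule ev_case_var, simp, simp,
        rule ev_foldr, (rule ev_rules ev_call[OF Cons] | simp)+)
qed

lemma fn_nl: "fn prog f_nl [enc_nat d] (enc_list (enc_list enc_gf8) (List.n_lists d gf8_list)) (d * (8 ^ d + 2))"
proof (induction d)
  case 0
  show ?case unfolding fn_prog b_nl_def by (rule ev_mono, (rule ev_rules | simp)+)
next
  case (Suc d)
  let ?L = "List.n_lists d gf8_list"
  have *: "length ?L = 8 ^ d" by (simp add: length_n_lists length_gf8_list)
  have "d * 8 ^ d \<le> d * (8 * 8 ^ d)" by simp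
  then show ?case
    unfolding fn_prog b_nl_def
    by - (rule ev_mono, (rule ev_rules ev_call[OF Suc]
       ev_call[OF fn_ext[of ?L]] | simp add: * algebra_simps)+)
qed

section \<open>Locating literals and building coordinate lists\<close>

lemma fn_pos:
  "fn prog f_pos [enc_nat v, enc_nat a, enc_nat d] (enc_nat (pos v a d)) (a + v + 2)"
proof (cases "a \<le> v")
  case True
  then obtain p where v: "v = a + p" by (auto simp: le_iff_add)
  have *: "Suc v - a = Suc p" using v by simp
  show ?thesis
  proof (cases "p < d")
    case True
    then obtain q where q: "d - p = Suc q" using True by (cases "d - p") auto
    have p: "pos v a d = Suc p" using True v by (simp add: pos_def)
    show ?thesis
      unfolding fn_prog b_pos_def p
      by (rule ev_mono, rule ev_case_call[OF fn_drop_nat[of "Suc v" a]], (rule ev_rules | simp add: *)+,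
        rule ev_case_call[OF fn_drop_nat[of d p]], (rule ev_rules | simp add: q)+) (simp add: v)
  next
    case False
    then have q: "d - p = 0" by simp
    have p: "pos v a d = 0" using False v by (simp add: pos_def)
    show ?thesis
      unfolding fn_prog b_pos_def p
      by (rule ev_mono, rule ev_case_call[OF fn_drop_nat[of "Suc v" a]], (rule ev_rules | simp add: *)+,
        rule ev_case_call[OF fn_drop_nat[of d p]], (rule ev_rules | simp add: q)+) (simp add: v)
  qed
next
  case False
  then have *: "Suc v - a = 0" "pos v a d = 0" by (simp_all add: pos_def)
  show ?thesis
    unfolding fn_prog b_pos_def *(2)
    by (rule ev_mono, rule ev_case_call[OF fn_drop_nat[of "Suc v" a]], (rule ev_rules | simp add: *(1))+)
qed

lemma fn_nth:
  "n < length xs \<Longrightarrow> fn prog f_nth [enc_list f xs, enc_nat n] (f (xs ! n)) (n + 1)"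
  unfolding fn_prog b_nth_def
  by (rule ev_mono, rule ev_case_call[OF fn_drop[of f xs n]],
     (rule ev_rules | simp add: Cons_nth_drop_Suc[symmetric])+)

lemma fn_ent:
  assumes "\<And>p. p \<in> set c \<Longrightarrow> fst p \<le> N"
  shows "fn prog f_ent [enc_list enc_literal c, enc_nat a, enc_nat d, enc_nat s, enc_bool b]
     (enc_nat (entry c a d s b)) (s + a + N + 4)"
proof (cases "s < length c")
  case False
  then have *: "drop s c = []" "entry c a d s b = 0" by (simp_all add: entry_def)
  show ?thesis
    unfolding fn_prog b_ent_def *(2)
    by (rule ev_mono, rule ev_case_call[OF fn_drop[of enc_literal c s]], (rule ev_rules
        | simp add: *(1))+)
next
  case True
  obtain v b' where vb: "c ! s = (v, b')" by (cases "c ! s")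
  then have v: "v \<le> N" using assms[OF nth_mem[OF True]] by simp
  have *: "drop s c = (v, b') # drop (Suc s) c" using vb True by (metis Cons_nth_drop_Suc)
  have e: "entry c a d s b = (if b' = b then pos v a d else 0)" using True vb by (simp add: entry_def)
  show ?thesis
    unfolding fn_prog b_ent_def e
    by (cases b; cases b'; (rule ev_mono, rule ev_case_call[OF fn_drop[of enc_literal c s]],
     (rule ev_rules ev_call[OF fn_pos[of v a d]] | simp add: * enc_literal_def enc_bool_def)+))
         (use v in simp_all)
qed

lemma fn_locs:
  assumes "\<And>c p. c \<in> set cs \<Longrightarrow> p \<in> set c \<Longrightarrow> fst p \<le> N"
  shows "fn prog f_locs [enc_nat r, enc_list (enc_list enc_literal) cs, enc_nat a, enc_nat d,
     enc_nat s, enc_bool b] (enc_list enc_nat (locs r cs a d s b)) (r * (s + a + N + 6))"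
  using assms
proof (induction r arbitrary: cs)
  case 0
  show ?case unfolding fn_prog b_locs_def by (rule ev_mono, (rule ev_rules | simp)+)
next
  case (Suc r)
  show ?case
  proof (cases cs)
    case Nil
    note IH = Suc.IH[of "[]", simplified]
    show ?thesis unfolding fn_prog b_locs_def Nil
      by (rule ev_mono, (rule ev_rules ev_call[OF IH] | simp)+)
  next
    case (Cons c cs')
    have IH: "fn prog f_locs [enc_nat r, enc_list (enc_list enc_literal) cs', enc_nat a, enc_nat d,
     enc_nat s, enc_bool b] (enc_list enc_nat (locs r cs' a d s b)) (r * (s + a + N + 6))"
      by (rule Suc.IH) (use Suc.prems Cons in auto)
    have e: "fn prog f_ent [enc_list enc_literal c, enc_nat a, enc_nat d, enc_nat s, enc_bool b]
     (enc_nat (entry c a d s b)) (s + a + N + 4)"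
      by (rule fn_ent) (use Suc.prems Cons in auto)
    show ?thesis unfolding fn_prog b_locs_def Cons
      by (rule ev_mono, (rule ev_rules ev_call[OF IH] ev_call[OF e] | simp)+)
  qed
qed

lemma fn_par: "fn prog f_par [enc_list enc_nat L, enc_nat k] (enc_list enc_nat (diag L k)) (length L)"
proof (induction L arbitrary: k)
  case Nil
  show ?case unfolding fn_prog b_par_def by (rule ev_mono, (rule ev_rules | simp)+)
next
  case (Cons e L)
  show ?case unfolding fn_prog b_par_def
    by (cases e; (rule ev_mono, (rule ev_rules ev_call[OF Cons[of "Suc k"]] | simp)+))
qed

lemma fn_lin: "fn prog f_lin [enc_list enc_nat L] (enc_list enc_nat (filled L)) (length L)"
proof (induction L)
  case Nil
  show ?case unfolding fn_prog b_lin_def filled_def by (rule ev_mono, (rule ev_rules | simp)+)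
next
  case (Cons e L)
  show ?case unfolding fn_prog b_lin_def
    by (cases e; (rule ev_mono, (rule ev_rules ev_call[OF Cons[unfolded filled_def One_nat_def]]
        | simp add: filled_def)+))
qed

section \<open>Checking coordinates and filling truth tables\<close>

lemma sat_coords_Nil: "sat_coords R [] us vs"
  by (simp add: sat_coords_def)

lemma sat_coords_Cons: "sat_coords R (e # es) (x # us) vs \<longleftrightarrow>
    (e \<noteq> 0 \<longrightarrow> R x (vs ! (e - 1))) \<and> sat_coords R es us vs"
  by (simp add: sat_coords_def All_less_Suc2)

lemma fn_chk:
  assumes "length us = length es" "\<And>e. e \<in> set es \<Longrightarrow> e \<le> length vs"
  shows "fn prog f_chk [enc_list enc_nat es, enc_list enc_gf8 us, enc_list enc_gf8 vs, enc_rel R]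
     (enc_bool (sat_coords R es us vs)) (length es * (length vs + 20))"
  using assms
proof (induction es arbitrary: us)
  case Nil
  show ?case unfolding fn_prog b_chk_def
    by (rule ev_mono, (rule ev_rules | simp add: sat_coords_Nil enc_bool_def)+)
next
  case (Cons e es)
  then obtain x us' where us: "us = x # us'" by (cases us) auto
  have IH: "fn prog f_chk [enc_list enc_nat es, enc_list enc_gf8 us', enc_list enc_gf8 vs, enc_rel R]
     (enc_bool (sat_coords R es us' vs)) (length es * (length vs + 20))"
    by (rule Cons.IH) (use Cons.prems us in auto)
  show ?case
  proof (cases e)
    case 0
    show ?thesis unfolding fn_prog b_chk_def 0 us
      by (rule ev_mono, (rule ev_rules ev_call[OF IH] | simp add: sat_coords_Cons)+)
  next
    case (Suc p)
    then have p: "p < length vs" using Cons.prems(2)[of e] by simp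
    \<comment> \<open>Three lookups: the row of \<open>x\<close> in the table, coordinate
      \<open>p\<close> of \<open>vs\<close>, and the entry of that row. An encoded field element is
      itself the index.\<close>
    note n1 = fn_nth[of "gidx x" gf8_list "\<lambda>y. enc_list (\<lambda>z. enc_bool (R y z)) gf8_list",
        unfolded length_gf8_list, OF gidx_less, folded enc_rel_def, unfolded nth_gf8_list]
    note n2 = fn_nth[OF p, of enc_gf8, unfolded enc_gf8_def[of "vs ! p"]]
    note n3 = fn_nth[of "gidx (vs ! p)" gf8_list "\<lambda>z. enc_bool (R x z)",
        unfolded length_gf8_list, OF gidx_less, unfolded nth_gf8_list]
    \<comment> \<open>Two indices of at most 7, together with the lookup at
      \<open>p < length vs\<close> and the calls themselves, account for the constant 20.\<close>
    have g: "gidx x + gidx (vs ! p) \<le> 14" using gidx_less[of x] gidx_less[of "vs ! p"] by simp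
    have b: "enc_bool True = Node Leaf Leaf" "enc_bool False = Leaf" by (simp_all add: enc_bool_def)
    show ?thesis
      unfolding fn_prog b_chk_def Suc us
      by (cases "R x (vs ! p)"; rule ev_mono, (rule ev_rules | simp)+,
         rule ev_case_call[OF n3], rule evl_Cons, rule ev_call[OF n1],
         (rule ev_rules | simp add: enc_gf8_def)+, rule ev_call[OF n2],
         (rule ev_rules ev_call[OF IH] | simp add: sat_coords_Cons b)+)
        (use g p in simp_all)
  qed
qed

lemma fn_row:
  assumes "length u = length es" "\<And>v. v \<in> set vs
      \<Longrightarrow> length v = d" "\<And>e. e \<in> set es \<Longrightarrow> e \<le> d"
  shows "fn prog f_row [enc_list (enc_list enc_gf8) vs, enc_list enc_gf8 u, enc_list enc_nat es, enc_rel R]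
     (enc_list (\<lambda>v. enc_bool (sat_coords R es u v)) vs) (length vs * (length es * (d + 20) + 2))"
  using assms(2)
proof (induction vs)
  case Nil
  show ?case unfolding fn_prog b_row_def by (rule ev_mono, (rule ev_rules | simp)+)
next
  case (Cons v vs)
  have IH: "fn prog f_row [enc_list (enc_list enc_gf8) vs, enc_list enc_gf8 u, enc_list enc_nat es, enc_rel R]
     (enc_list (\<lambda>v. enc_bool (sat_coords R es u v)) vs) (length vs * (length es * (d + 20) + 2))"
    by (rule Cons.IH) (use Cons.prems in auto)
  have chk: "fn prog f_chk [enc_list enc_nat es, enc_list enc_gf8 u, enc_list enc_gf8 v, enc_rel R]
     (enc_bool (sat_coords R es u v)) (length es * (d + 20))"
    using fn_chk[of u es v R] assms(1,3) Cons.prems[of v] by simp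
  show ?case unfolding fn_prog b_row_def
    by (rule ev_mono, (rule ev_rules ev_call[OF chk] ev_call[OF IH] | simp)+)
qed

lemma fn_tab:
  assumes "\<And>u. u \<in> set us \<Longrightarrow> length u
      = length es" "\<And>v. v \<in> set vs \<Longrightarrow> length v = d"
    and "\<And>e. e \<in> set es \<Longrightarrow> e \<le> d"
  shows "fn prog f_tab [enc_list (enc_list enc_gf8) us, enc_list (enc_list enc_gf8) vs,
       enc_list enc_nat es, enc_rel R]
     (enc_list (\<lambda>u. enc_list (\<lambda>v. enc_bool (sat_coords R es u v)) vs) us)
     (length us * (length vs * (length es * (d + 20) + 2) + 2))"
  using assms(1)
proof (induction us)
  case Nil
  show ?case unfolding fn_prog b_tab_def by (rule ev_mono, (rule ev_rules | simp)+)
next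
  case (Cons u us)
  have IH: "fn prog f_tab [enc_list (enc_list enc_gf8) us, enc_list (enc_list enc_gf8) vs,
       enc_list enc_nat es, enc_rel R]
     (enc_list (\<lambda>u. enc_list (\<lambda>v. enc_bool (sat_coords R es u v)) vs) us)
     (length us * (length vs * (length es * (d + 20) + 2) + 2))"
    by (rule Cons.IH) (use Cons.prems in auto)
  have row: "fn prog f_row [enc_list (enc_list enc_gf8) vs, enc_list enc_gf8 u, enc_list enc_nat es, enc_rel R]
     (enc_list (\<lambda>v. enc_bool (sat_coords R es u v)) vs) (length vs * (length es * (d + 20) + 2))"
    by (rule fn_row) (use assms(2,3) Cons.prems in auto)
  show ?case unfolding fn_prog b_tab_def
    by (rule ev_mono, (rule ev_rules ev_call[OF row] ev_call[OF IH] | simp)+)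
qed

section \<open>Lengths and ranges of coordinate lists, and the cost of one constraint\<close>

lemma length_locs [simp]: "length (locs r cs a d s b) = r"
  by (induction r arbitrary: cs) auto

lemma length_diag [simp]: "length (diag L k) = length L"
  by (induction L arbitrary: k) auto

lemma length_filled [simp]: "length (filled L) = length L"
  by (simp add: filled_def)

lemma nth_diag: "m < length L \<Longrightarrow> diag L k ! m = (if L ! m = 0 then 0 else Suc (k + m))"
  by (induction L arbitrary: k m) (auto simp: nth_Cons split: nat.split)

lemma entry_le: "entry c a d s b \<le> d"
  by (auto simp: entry_def pos_def)

lemma nth_locs: "k < r \<Longrightarrow>
   locs r cs a d s b ! k = (if k < length cs then entry (cs ! k) a d s b else 0)"
proof (induction r arbitrary: cs k)
  case (Suc r)
  then show ?case by (cases k; cases cs) auto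
qed simp

lemma nth_locs_le: "k < r \<Longrightarrow> locs r cs a d s b ! k \<le> d"
  by (simp add: nth_locs entry_le)

lemma length_coords [simp]: "length (coords d \<phi> c) = d"
  by (cases "(d, \<phi>, c)" rule: coords.cases) (simp add: Let_def)

text \<open>An entry 0 becomes 1, which is at most \<open>d\<close> because
  \<open>k < d\<close>.\<close>

lemma filled_locs_le: "k < d \<Longrightarrow> Suc (locs d cs a d s b ! k - 1) \<le> d"
  using nth_locs_le[of k d cs a d s b] by linarith

lemma coords_le: "e \<in> set (coords d \<phi> c) \<Longrightarrow> e \<le> d"
  by (cases "(d, \<phi>, c)" rule: coords.cases)
    (auto simp: Let_def in_set_conv_nth nth_diag filled_def nth_locs_le split: if_splits
      intro: filled_locs_le[simplified])

text \<open>From here on one number \<open>S\<close> bounds all parameters, so that counts become a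
  constant times a power of \<open>S\<close>. The largest \<open>q\<close> used is 13.\<close>

lemma ev_name:
  assumes "env ! 4 = enc_nat l" "4 < length env" "ev prog env ei
      (enc_nat i) 0" "ev prog env ej (enc_nat j) 0"
    and "q \<le> 13" "i \<le> S" "l \<le> S" "1 \<le> S"
  shows "ev prog env (e_name q ei ej) (enc_nat (name l q i j)) (112 * S ^ 2)"
  unfolding e_name_def name_def
proof (rule ev_mono)
  show "ev prog env (ECall f_add [ECall f_mul [ECall f_add [ECall f_mul [quote (enc_nat q), EVar 4],
      ei], EVar 4], ej]) (enc_nat ((q * l + i) * l + j))
    ((q * l + i) * l + (q * l + (q * (l + 2) + 1) + 1 + (q * l + i) * (l + 2) + 1) + 1)"
    by (rule ev_mono, rule ev_call[OF fn_add], rule evl_Cons, rule ev_call[OF fn_mul], rule evl_Cons,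
      rule ev_call[OF fn_add], rule evl_Cons, rule ev_call[OF fn_mul],
      (rule evl_Cons evl_Nil assms ev_quote ev_var | simp add: assms)+)
  have A: "q * l \<le> 13 * S" using assms by (intro mult_le_mono)
  have B: "(q * l + i) * l \<le> (14 * S) * S" using A assms by (intro mult_le_mono) auto
  have S: "S \<le> S * S" using assms(8) by simp
  have "(q * l + i) * l + (q * l + (q * (l + 2) + 1) + 1 + (q * l + i) * (l + 2) + 1) + 1
      = 2 * ((q * l + i) * l) + 4 * (q * l) + 2 * q + 2 * i + 4"
    by (simp add: algebra_simps)
  also have "\<dots> \<le> 2 * (14 * S * S) + 4 * (13 * S) + 26 + 2 * S + 4"
    using A B assms by linarith
  \<comment> \<open>Every lower term is raised to \<open>S * S\<close>: 28 + 52 + 26 + 2 + 4 =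
    112.\<close>
  also have "\<dots> \<le> 112 * (S * S)" using S assms(8) by linarith
  finally show "(q * l + i) * l + (q * l + (q * (l + 2) + 1) + 1 + (q * l + i) * (l + 2) + 1) + 1
    \<le> 112 * S\<^sup>2"
    by (simp add: power2_eq_square)
qed

lemma ev_locs:
  assumes "env ! 1 = enc_nat j" "env ! 3 = enc_nat i" "env ! 5 = enc_nat d"
    and "env ! 6 = enc_list (enc_list enc_literal) \<phi>" "6 < length env"
    and "\<And>c p. c \<in> set \<phi> \<Longrightarrow> p \<in> set c \<Longrightarrow> fst p \<le> S"
    and "i \<le> S" "j \<le> S" "d \<le> S" "s \<le> 2" "1 \<le> S"
  shows "ev prog env (e_locs s b) (enc_list enc_nat (locs d (drop (i * d) \<phi>) (j * d) d s b))
      (21 * S ^ 3)"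
  unfolding e_locs_def
proof (rule ev_mono)
  have *: "fn prog f_locs [enc_nat d, enc_list (enc_list enc_literal) (drop (i * d) \<phi>), enc_nat (j * d),
      enc_nat d, enc_nat s, enc_bool b]
      (enc_list enc_nat (locs d (drop (i * d) \<phi>) (j * d) d s b)) (d * (s + j * d + S + 6))"
    by (rule fn_locs) (meson assms(6) in_set_dropD)
  have v: "ev prog env (EVar 1) (enc_nat j) 0" "ev prog env (EVar 3) (enc_nat i) 0"
    "ev prog env (EVar 5) (enc_nat d) 0" "ev prog env (EVar 6)
        (enc_list (enc_list enc_literal) \<phi>) 0"
    by (rule ev_var; use assms(1-5) in simp)+
  show "ev prog env (ECall f_locs [EVar 5, ECall f_drop [EVar 6, ECall f_mul [EVar 3, EVar 5]],
     ECall f_mul [EVar 1, EVar 5], EVar 5, quote (enc_nat s), quote (enc_bool b)])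
     (enc_list enc_nat (locs d (drop (i * d) \<phi>) (j * d) d s b))
     (d * (s + j * d + S + 6) + ((i * d + (i * (d + 2) + 1) + 1) + (j * (d + 2) + 1)) + 1)"
    by (rule ev_mono, (rule v ev_call[OF *] ev_call[OF fn_drop] ev_call[OF fn_mul] ev_quote
      evl_Cons evl_Nil)+) (simp add: algebra_simps)
  have jd: "j * d \<le> S * S" "i * d \<le> S * S" using assms by (intro mult_le_mono; simp)+
  have "d * (s + j * d + S + 6) \<le> S * (2 + S * S + S + 6)" using jd assms
      by (intro mult_le_mono) auto
  then have "d * (s + j * d + S + 6) \<le> S * S * S + S * S + 8 * S" by (simp add: algebra_simps)
  moreover have "S \<le> S * S" "S * S \<le> S * S * S" using assms(11) by simp_all
  moreover have "(i * d + (i * (d + 2) + 1) + 1) + (j * (d + 2) + 1)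
      = 2 * (i * d) + j * d + 2 * i + 2 * j + 3"
    by (simp add: algebra_simps)
  ultimately have "d * (s + j * d + S + 6) + ((i * d + (i * (d + 2) + 1) + 1) + (j * (d + 2) + 1)) + 1 \<le> 21 * (S * S * S)"
    using jd assms by linarith
  then show "d * (s + j * d + S + 6) + ((i * d + (i * (d + 2) + 1) + 1) + (j * (d + 2) + 1)) + 1
      \<le> 21 * S ^ 3"
    by (simp add: power3_eq_cube)
qed

definition enc_con :: "nat \<Rightarrow> nat \<Rightarrow> cnf \<Rightarrow> con \<Rightarrow> tree" where
  "enc_con l d \<phi> c = Node (enc_nat (lvar l c)) (Node (enc_nat (rvar l c))
     (enc_list (\<lambda>u. enc_list (\<lambda>v. enc_bool (sat_coords (rel (snd c)) (coords d \<phi> c) u v))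
       (List.n_lists d gf8_list)) (List.n_lists d gf8_list)))"

text \<open>The most expensive case is \<open>t \<ge> 2\<close>, where the passes of
  \<open>f_lin\<close> and \<open>f_par\<close> add \<open>2 * d + 2\<close> to the cost of
  \<open>e_locs\<close>.\<close>

lemma ev_coords:
  assumes L: "ev prog env (e_locs s b) (enc_list enc_nat (locs d (drop (i * d) \<phi>) (j * d) d s b)) (21 * S ^ 3)"
    and d: "d \<le> S" "1 \<le> S"
  shows "ev prog env (e_coords (t, s, b)) (enc_list enc_nat (coords d \<phi> ((i, j), (t, s, b))))
      (25 * S ^ 3)"
proof -
  let ?L = "locs d (drop (i * d) \<phi>) (j * d) d s b"
  have 0: "ev prog env ELeaf (enc_nat 0) 0" by (simp add: ev_leaf)
  have S: "d \<le> S ^ 3" "1 \<le> S ^ 3" using d self_le_power[of S 3] by auto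
  have lin: "ev prog env (ECall f_lin [e_locs s b]) (enc_list enc_nat (filled ?L)) (d + 21 * S ^ 3 + 1)"
    by (rule ev_mono, rule ev_call[OF fn_lin], rule evl_Cons[OF L evl_Nil]) simp
  consider "t = 0" | "t = 1" | "t \<ge> 2" by linarith
  then show ?thesis
  proof cases
    case 1
    have "ev prog env (ECall f_par [e_locs s b, ELeaf]) (enc_list enc_nat (diag ?L 0)) (25 * S ^ 3)"
      by (rule ev_mono, rule ev_call[OF fn_par], rule evl_Cons[OF L evl_Cons[OF 0 evl_Nil]])
          (use S in simp)
    then show ?thesis using 1 by (simp add: e_coords_def)
  next
    case 2
    have "ev prog env (ECall f_lin [e_locs s b]) (enc_list enc_nat (filled ?L)) (25 * S ^ 3)"
      by (rule ev_mono, rule lin) (use S in simp)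
    then show ?thesis using 2 by (simp add: e_coords_def)
  next
    case 3
    have "ev prog env (ECall f_par [ECall f_lin [e_locs s b], ELeaf])
      (enc_list enc_nat (diag (filled ?L) 0)) (25 * S ^ 3)"
      by (rule ev_mono, rule ev_call[OF fn_par], rule evl_Cons[OF lin evl_Cons[OF 0 evl_Nil]])
          (use S in simp)
    then show ?thesis using 3 by (simp add: e_coords_def)
  qed
qed

lemma length_vecs: "v \<in> set (List.n_lists d gf8_list) \<Longrightarrow> length v = d"
  by (simp add: set_n_lists)

lemma ev_con:
  assumes env: "env ! 1 = enc_nat j" "env ! 3 = enc_nat i" "env ! 4 = enc_nat l" "env ! 5 = enc_nat d"
      "env ! 6 = enc_list (enc_list enc_literal) \<phi>"
      "env ! 7 = enc_list (enc_list enc_gf8) (List.n_lists d gf8_list)" "7 < length env"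
    and lits: "\<And>c p. c \<in> set \<phi> \<Longrightarrow> p \<in> set c
        \<Longrightarrow> fst p \<le> S"
    and S: "i \<le> S" "j \<le> S" "l \<le> S" "d \<le> S" "8 ^ d \<le> S" "1
        \<le> S" and k: "k \<in> set kinds"
  shows "ev prog env (e_con k) (enc_con l d \<phi> ((i, j), k)) (300 * S ^ 4)"
proof -
  obtain t s b where tsb: "k = (t, s, b)" by (cases k)
  have s: "s \<le> 2" using k tsb by (auto simp: kinds_def)
  then have slot: "slot s b \<le> 7" by (simp add: slot_def)
  let ?coords = "coords d \<phi> ((i, j), (t, s, b))" and ?L = "List.n_lists d gf8_list"
  have v: "ev prog env (EVar 1) (enc_nat j) 0" "ev prog env (EVar 3) (enc_nat i) 0"
    by (rule ev_var; use env in simp)+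
  have z: "ev prog env ELeaf (enc_nat 0) 0" by (simp add: ev_leaf)
  have vecs: "ev prog env (EVar 7) (enc_list (enc_list enc_gf8) ?L) 0"
    by (rule ev_var; use env in simp)
  have names: "ev prog env (e_name q (EVar 3) (EVar 1)) (enc_nat (name l q i j)) (112 * S ^ 2)"
      "ev prog env (e_name q (EVar 3) ELeaf) (enc_nat (name l q i 0)) (112 * S ^ 2)"
      "ev prog env (e_name q ELeaf (EVar 1)) (enc_nat (name l q 0 j)) (112 * S ^ 2)" if "q
          \<le> 13" for q
    by (rule ev_name; use env S that v z in simp)+
  have l: "ev prog env (if t = 1 then e_name (slot s b) (EVar 3) (EVar 1)
        else e_name (6 + slot s b) (EVar 3) (EVar 1)) (enc_nat (lvar l ((i, j), k))) (112 * S ^ 2)"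
    using names(1)[of "slot s b"] names(1)[of "6 + slot s b"] slot by (simp add: tsb)
  have r: "ev prog env (if t = 0 then e_name (slot s b) (EVar 3) (EVar 1)
          else if t = 1 then e_name 12 ELeaf (EVar 1) else e_name 13 (EVar 3) ELeaf)
      (enc_nat (rvar l ((i, j), k))) (112 * S ^ 2)"
    using names(1)[of "slot s b"] names(2)[of 13] names(3)[of 12] slot by (simp add: tsb)
  have coords: "ev prog env (e_coords k) (enc_list enc_nat ?coords) (25 * S ^ 3)"
    unfolding tsb by (rule ev_coords[OF ev_locs]) (use env S s lits in simp_all)
  have len: "length ?L = 8 ^ d" by (simp add: length_n_lists length_gf8_list)
  have "fn prog f_tab [enc_list (enc_list enc_gf8) ?L, enc_list (enc_list enc_gf8) ?L,
       enc_list enc_nat ?coords, enc_rel (rel k)]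
     (enc_list (\<lambda>u. enc_list (\<lambda>v. enc_bool (sat_coords (rel k) ?coords u v)) ?L) ?L)
     (length ?L * (length ?L * (length ?coords * (d + 20) + 2) + 2))"
    by (rule fn_tab) (auto simp: length_vecs length_coords simp del: coords.simps dest: coords_le)
  moreover have "length ?L * (length ?L * (length ?coords * (d + 20) + 2) + 2)
      \<le> S * (S * (S * (S + 20) + 2) + 2)"
    unfolding len length_coords using S by (intro mult_le_mono add_le_mono) auto
  ultimately have tab: "fn prog f_tab [enc_list (enc_list enc_gf8) ?L, enc_list (enc_list enc_gf8) ?L,
       enc_list enc_nat ?coords, enc_rel (rel k)]
     (enc_list (\<lambda>u. enc_list (\<lambda>v. enc_bool (sat_coords (rel k) ?coords u v)) ?L) ?L)
     (S * (S * (S * (S + 20) + 2) + 2))"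
    by (rule fn_mono)
  have pw: "S ^ 2 \<le> S ^ 4" "S ^ 3 \<le> S ^ 4" "S \<le> S ^ 4" "1 \<le> S ^ 4"
    using S(6) power_increasing[of _ 4 S] self_le_power[of S 4] by auto
  have "S * (S * (S * (S + 20) + 2) + 2) = S ^ 4 + 20 * S ^ 3 + 2 * S ^ 2 + 2 * S"
    by (simp add: eval_nat_numeral algebra_simps)
  then have bound: "112 * S ^ 2 + (112 * S ^ 2 + (S * (S * (S * (S + 20) + 2) + 2) + (0 + (0 +
      (25 * S ^ 3 + (0 + 0)))) + 1))
      \<le> 300 * S ^ 4"
    using pw by linarith
  \<comment> \<open>Moves the conditional out of the argument of \<open>e_name\<close>, to match the
    form of \<open>l\<close>.\<close>
  have e: "e_con k = ENode (if t = 1 then e_name (slot s b) (EVar 3) (EVar 1)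
        else e_name (6 + slot s b) (EVar 3) (EVar 1))
       (ENode (if t = 0 then e_name (slot s b) (EVar 3) (EVar 1)
          else if t = 1 then e_name 12 ELeaf (EVar 1) else e_name 13 (EVar 3) ELeaf)
         (ECall f_tab [EVar 7, EVar 7, e_coords k, quote (enc_rel (rel k))]))"
    by (simp add: tsb)
  show ?thesis
    unfolding e enc_con_def snd_conv tsb[symmetric]
    by (rule ev_mono[OF ev_node[OF l ev_node[OF r ev_call[OF tab[unfolded tsb[symmetric]]
        evl_Cons[OF vecs
      evl_Cons[OF vecs evl_Cons[OF coords[unfolded tsb[symmetric]]
          evl_Cons[OF ev_quote evl_Nil]]]]]]] bound])
qed

section \<open>The loops over pairs of blocks and the whole run\<close>

lemma product_append: "List.product (xs @ ys) zs = List.product xs zs @ List.product ys zs"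
  by (induction xs) auto

text \<open>The counter descends, hence \<open>rev\<close>. Each round emits the 72 kinds at
  \<open>300 * S ^ 4\<close> calls each and makes one recursive call.\<close>

lemma fn_cells:
  assumes lits: "\<And>c p. c \<in> set \<phi> \<Longrightarrow> p \<in> set c
      \<Longrightarrow> fst p \<le> S"
    and S: "i \<le> S" "j \<le> S" "l \<le> S" "d \<le> S" "8 ^ d \<le> S" "1 \<le> S"
  shows "fn prog f_cells [enc_nat j, enc_nat i, enc_nat l, enc_nat d, enc_list (enc_list enc_literal) \<phi>,
      enc_list (enc_list enc_gf8) (List.n_lists d gf8_list), enc_list (enc_con l d \<phi>) cs]
    (enc_list (enc_con l d \<phi>) (List.product (map (Pair i) (rev [0..<j])) kinds @ cs))
    (j * (72 * (300 * S ^ 4) + 1))"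
  using S(2)
proof (induction j)
  case 0
  show ?case unfolding fn_prog b_cells_def by (rule ev_mono, (rule ev_rules | simp)+)
next
  case (Suc j)
  have len: "length kinds = 72" by (simp add: kinds_def)
  let ?env = "[Leaf, enc_nat j, Node Leaf (enc_nat j), enc_nat i, enc_nat l, enc_nat d,
    enc_list (enc_list enc_literal) \<phi>,
    enc_list (enc_list enc_gf8) (List.n_lists d gf8_list), enc_list (enc_con l d \<phi>) cs]"
  have "ev prog ?env (ECall f_cells [EVar 1, EVar 3, EVar 4, EVar 5, EVar 6, EVar 7, EVar 8])
    (enc_list (enc_con l d \<phi>) (List.product (map (Pair i) (rev [0..<j])) kinds @ cs))
    (j * (72 * (300 * S ^ 4) + 1) + 0 + 1)"
    by (rule ev_mono, rule ev_call[OF Suc.IH]) (use Suc.prems in simp, (rule ev_rules | simp)+)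
  then have *: "ev prog ?env (foldr (\<lambda>k. ENode (e_con k)) kinds
      (ECall f_cells [EVar 1, EVar 3, EVar 4, EVar 5, EVar 6, EVar 7, EVar 8]))
    (enc_list (enc_con l d \<phi>) (map (\<lambda>k. ((i, j), k)) kinds @ List.product (map (Pair i) (rev [0..<j])) kinds @ cs))
    (length kinds * (300 * S ^ 4) + (j * (72 * (300 * S ^ 4) + 1) + 0 + 1))"
    by (intro ev_foldr ev_con) (use lits S Suc.prems in auto)
  show ?case unfolding fn_prog b_cells_def
    by (rule ev_mono, rule ev_case_var, simp, simp, rule *[simplified]) (use len in simp)
qed

lemma fn_rows:
  assumes lits: "\<And>c p. c \<in> set \<phi> \<Longrightarrow> p \<in> set c
      \<Longrightarrow> fst p \<le> S"
    and S: "i \<le> S" "l \<le> S" "d \<le> S" "8 ^ d \<le> S" "1 \<le> S"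
  shows "fn prog f_rows [enc_nat i, enc_nat l, enc_nat d, enc_list (enc_list enc_literal) \<phi>,
      enc_list (enc_list enc_gf8) (List.n_lists d gf8_list)]
    (enc_list (enc_con l d \<phi>) (List.product (List.product (rev [0..<i]) (rev [0..<l])) kinds))
    (i * (l * (72 * (300 * S ^ 4) + 1) + 2))"
  using S(1)
proof (induction i)
  case 0
  show ?case unfolding fn_prog b_rows_def by (rule ev_mono, (rule ev_rules | simp)+)
next
  case (Suc i)
  then have "i \<le> S" by simp
  \<comment> \<open>The inner loop starts at \<open>j = l\<close>, so \<open>l \<le> S\<close> is
    supplied twice.\<close>
  note IH = Suc.IH[OF this] and c = fn_cells[OF lits \<open>i \<le> S\<close> S(2,2-5)]
  show ?case unfolding fn_prog b_rows_def
    by (rule ev_mono, rule ev_case_var, simp, simp add: product_append, rule ev_call[OF c])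
      ((rule ev_rules ev_call[OF IH] | simp)+)
qed

text \<open>The order in which the program emits the constraints, which also numbers them in
  \<open>red\<close>.\<close>

definition cons_list :: "nat \<Rightarrow> con list" where
  "cons_list l = List.product (List.product (rev [0..<l]) (rev [0..<l])) kinds"

definition block_size :: "nat \<Rightarrow> nat \<Rightarrow> nat \<Rightarrow> nat" where
  "block_size l m n = max (cdiv m l) (cdiv n l)"

definition enc_out :: "nat \<Rightarrow> nat \<Rightarrow> cnf \<Rightarrow> tree" where
  "enc_out l d \<phi> = Node (enc_nat (48 * l ^ 2)) (Node (enc_nat d)
     (enc_list (enc_con l d \<phi>) (cons_list l)))"

lemma fn_out:
  assumes lits: "\<And>c p. c \<in> set \<phi> \<Longrightarrow> p \<in> set c
      \<Longrightarrow> fst p \<le> S"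
    and S: "l \<le> S" "d \<le> S" "8 ^ d \<le> S" "1 \<le> S"
  shows "fn prog f_out [enc_nat l, enc_list (enc_list enc_literal) \<phi>, enc_nat d] (enc_out l d \<phi>)
    (30000 * S ^ 6)"
proof -
  note rows = fn_rows[OF lits S(1,1-4)]
  have "fn prog f_out [enc_nat l, enc_list (enc_list enc_literal) \<phi>, enc_nat d] (enc_out l d \<phi>)
    ((48 * (l * l + 2) + (l * (l + 2) + 1) + 1) + (l * (l * (72 * (300 * S ^ 4) + 1) + 2) + (d * (8 ^ d + 2) + 1) + 1))"
    unfolding fn_prog b_out_def enc_out_def cons_list_def power2_eq_square
    by (rule ev_mono, (rule ev_rules ev_call[OF fn_mul] ev_call[OF rows] ev_call[OF fn_nl] | simp)+)
  moreover have "l * l \<le> S * S" "d * 8 ^ d \<le> S * S" using S by (auto intro: mult_le_mono)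
  moreover have "l * l * S ^ 4 \<le> S * S * S ^ 4" using S by (intro mult_le_mono) auto
  moreover have "S * S \<le> S ^ 6" "S \<le> S ^ 6" "1 \<le> S ^ 6"
    using S(4) power_increasing[of 2 6 S] self_le_power[of S 6] by (auto simp: power2_eq_square)
  moreover have "S * S * S ^ 4 = S ^ 6" by (simp add: eval_nat_numeral)
  moreover have "(48 * (l * l + 2) + (l * (l + 2) + 1) + 1) + (l * (l * (72 * (300 * S ^ 4) + 1) + 2) + (d * (8 ^ d + 2) + 1) + 1)
    = 50 * (l * l) + 4 * l + 21600 * (l * l * S ^ 4) + d * 8 ^ d + 2 * d + 100"
    by (simp add: algebra_simps)
  moreover note S
  ultimately show ?thesis by (elim fn_mono) linarith
qed

lemma fn_main:
  assumes lits: "\<And>c p. c \<in> set \<phi> \<Longrightarrow> p \<in> set c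
      \<Longrightarrow> fst p \<le> S"
    and S: "l \<le> S" "8 ^ block_size l (length \<phi>) n \<le> S" "n \<le> S" "length \<phi>
        \<le> S" "0 < l"
  shows "fn prog f_main [enc_input l n \<phi>] (enc_out l (block_size l
      (length \<phi>) n) \<phi>) (30030 * S ^ 6)"
proof -
  let ?m = "length \<phi>"
  let ?d = "block_size l ?m n"
  have d: "?d \<le> S"
  proof -
    have "?d < 2 ^ ?d" by simp
    also have "(2 :: nat) ^ ?d \<le> 8 ^ ?d" by (rule power_mono) simp_all
    finally show ?thesis using S(2) by simp
  qed
  have S1: "1 \<le> S" using S by linarith
  have d_eq: "cdiv ?m l + (cdiv n l - cdiv ?m l) = ?d" by (simp add: block_size_def)
  note out = fn_out[OF lits S(1) d S(2) S1]
  note cm = fn_cdiv[OF S(5), of "enc_list enc_literal" \<phi>]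
  have cn: "fn prog f_cdiv [enc_nat n, enc_nat l] (enc_nat (cdiv n l)) (n * (l + 2))"
    using fn_cdiv[OF S(5), of "\<lambda>_. Leaf" "replicate n ()"] by (simp add: enc_nat_eq)
  note add = fn_add[of "cdiv ?m l" "cdiv n l - cdiv ?m l", unfolded d_eq]
  have "fn prog f_main [enc_input l n \<phi>] (enc_out l ?d \<phi>)
     (30000 * S ^ 6 + (cdiv ?m l + ((?m * (l + 2) + 1) + (cdiv ?m l + ((n * (l + 2) + 1) + (?m * (l + 2) + 1)) + 1)) + 1) + 1)"
    unfolding fn_prog b_main_def enc_input_def
    by (rule ev_mono, (rule ev_case_var, simp, simp)+, rule ev_call[OF out])
      (rule ev_rules ev_call[OF add] ev_call[OF cm] ev_call[OF cn] ev_call[OF fn_drop_nat] | simp)+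
  moreover have "cdiv ?m l \<le> S" using d by (simp add: block_size_def)
  moreover have "?m * (l + 2) \<le> S * (S + 2)" "n * (l + 2) \<le> S * (S + 2)" using S
      by (intro mult_le_mono; simp)+
  moreover have "S * (S + 2) = S * S + 2 * S" by (simp add: algebra_simps)
  moreover have "S * S \<le> S ^ 6" "S \<le> S ^ 6" "1 \<le> S ^ 6"
    using S1 power_increasing[of 2 6 S] self_le_power[of S 6] by (auto simp: power2_eq_square)
  ultimately show ?thesis by (elim fn_mono) linarith
qed

lemma runs_on_prog:
  assumes "\<And>c p. c \<in> set \<phi> \<Longrightarrow> p \<in> set c \<Longrightarrow> fst p \<le> S"
    and "l \<le> S" "8 ^ block_size l (length \<phi>) n \<le> S" "n \<le> S" "length \<phi>
        \<le> S" "0 < l"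
  shows "\<exists>t. runs_on prog (enc_input l n \<phi>) (enc_out l (block_size l
      (length \<phi>) n) \<phi>) t \<and>
    t \<le> 40000 * call_cost prog * S ^ 6"
proof -
  have "ev prog [enc_input l n \<phi>] (ECall f_main [EVar 0]) (enc_out l (block_size l
      (length \<phi>) n) \<phi>)
     (30030 * S ^ 6 + (0 + 0) + 1)"
    by (rule ev_call[OF fn_main[OF assms]], simp, (rule ev_rules | simp)+)
  \<comment> \<open>The summand 2 is the size of the start expression
    \<open>ECall f_main [EVar 0]\<close>.\<close>
  then obtain t where t: "runs_on prog (enc_input l n \<phi>) (enc_out l (block_size l
      (length \<phi>) n) \<phi>) t"
      "t \<le> 2 + (30030 * S ^ 6 + 1) * call_cost prog"
    unfolding ev_def runs_on_def f_main_def by auto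
  have "1 \<le> S ^ 6" "1 \<le> call_cost prog" using assms by (auto simp: call_cost_def)
  then have "1 \<le> S ^ 6 * call_cost prog" "call_cost prog \<le> S ^ 6 * call_cost prog" by auto
  then have "2 + (30030 * S ^ 6 + 1) * call_cost prog \<le> 40000 * (S ^ 6 * call_cost prog)"
    unfolding add_mult_distrib by linarith
  with t show ?thesis by (auto simp: mult_ac)
qed

section \<open>The constraint satisfaction problem\<close>

definition sat_vec :: "(gf8 \<Rightarrow> gf8 \<Rightarrow> bool) \<Rightarrow> nat list \<Rightarrow> gf8 vec \<Rightarrow> gf8 vec \<Rightarrow> bool" where
  "sat_vec R es u v \<longleftrightarrow> (\<forall>k<length es. es ! k \<noteq> 0 \<longrightarrow> R (u $ k) (v $ (es ! k - 1)))"

definition red :: "nat \<Rightarrow> nat \<Rightarrow> cnf \<Rightarrow> (nat, nat, gf8 vec) csp" where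
  "red l d \<phi> = \<lparr>Vars = {..<48 * l ^ 2}, Cons = {..<72 * l ^ 2},
     lend = (\<lambda>e. lvar l (cons_list l ! e)), rend = (\<lambda>e. rvar l (cons_list l ! e)),
     Alph = carrier_vec d,
     Valid = (\<lambda>e. sat_vec (rel (snd (cons_list l ! e))) (coords d \<phi> (cons_list l ! e)))\<rparr>"

lemma enc_list_map: "enc_list f (map g xs) = enc_list (\<lambda>x. f (g x)) xs"
  by (induction xs) auto

lemma length_kinds: "length kinds = 72"
  by (simp add: kinds_def)

lemma length_cons_list: "length (cons_list l) = 72 * l ^ 2"
  by (simp add: cons_list_def length_kinds power2_eq_square)

lemma set_cons_list:
  "((i, j), (t, s, b)) \<in> set (cons_list l) \<longleftrightarrow> i < l \<and> j < l \<and> t < 12 \<and> s < 3"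
  by (auto simp: cons_list_def kinds_def)

lemma distinct_cons_list: "distinct (cons_list l)"
  by (simp add: cons_list_def kinds_def distinct_product)

lemma sat_vec_of_list: "sat_vec R es (vec_of_list u) (vec_of_list v) = sat_coords R es u v"
  by (simp add: sat_vec_def sat_coords_def vec_of_list_index)

text \<open>Both truth tables follow the order of \<open>List.n_lists\<close>, one over lists and
  one over vectors; \<open>sat_vec_of_list\<close> identifies their entries.\<close>

lemma describes_red: "describes_csp d (enc_out l d \<phi>) (red l d \<phi>)"
proof -
  have "enc_list (enc_con l d \<phi>) (cons_list l) =
    enc_list (enc_con l d \<phi>) (map (\<lambda>e. cons_list l ! e) [0..<72 * l ^ 2])"
    using map_nth[of "cons_list l"] by (simp add: length_cons_list)
  then show ?thesis
    by (simp add: describes_csp_def enc_out_def red_def enc_list_map enc_con_def enc_table_def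
      gf8_vecs_def sat_vec_of_list)
qed

text \<open>If every coordinate of \<open>u\<close> must equal a selected coordinate of
  \<open>v\<close>, then \<open>u\<close> is the product of \<open>v\<close> with a 0/1 matrix that
  has a single 1 in each row.\<close>

lemma linear_sat_vec:
  assumes "length es = d" "\<And>k. k < d \<Longrightarrow> es ! k \<noteq> 0" "\<And>k. k < d \<Longrightarrow> es ! k \<le> d"
  shows "linear_constraint d (sat_vec (=) es)"
proof -
  define M where "M = mat d d (\<lambda>(k, c). if c = es ! k - 1 then 1 else (0 :: gf8))"
  have "sat_vec (=) es u v \<longleftrightarrow> u = M *\<^sub>v v"
    if u: "u \<in> carrier_vec d" and v: "v \<in> carrier_vec d" for u v
  proof -
    have "(M *\<^sub>v v) $ k = v $ (es ! k - 1)" if "k < d" for k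
    proof -
      have "es ! k - 1 < d" using assms(2,3)[OF that] that by linarith
      have "(M *\<^sub>v v) $ k = (\<Sum>c = 0..<d. (if c = es ! k - 1 then 1 else 0) * v $ c)"
        using that v by (simp add: M_def scalar_prod_def)
      also have "\<dots> = (\<Sum>c = 0..<d. if c = es ! k - 1 then v $ c else 0)"
        by (rule sum.cong) auto
      also have "\<dots> = v $ (es ! k - 1)" using \<open>es ! k - 1 < d\<close> by simp
      finally show ?thesis .
    qed
    moreover have "dim_vec (M *\<^sub>v v) = d" by (simp add: M_def)
    ultimately show ?thesis
      using u assms(1,2) by (auto simp: sat_vec_def vec_eq_iff)
  qed
  then show ?thesis
    unfolding linear_constraint_def by (intro bexI[of _ M]) (auto simp: M_def)
qed

lemma parallel_sat_vec:
  assumes "length es = d" "\<And>k. k < d \<Longrightarrow> es ! k \<in> {0, Suc k}"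
  shows "parallel_constraint d (sat_vec R es)"
  unfolding parallel_constraint_def
proof (intro exI conjI ballI)
  show "{k. k < d \<and> es ! k \<noteq> 0} \<subseteq> {..<d}" by auto
  fix u v
  show "sat_vec R es u v \<longleftrightarrow> (\<forall>k\<in>{k. k < d \<and> es ! k \<noteq> 0}. R (u $ k) (v $ k))"
    using assms unfolding sat_vec_def by (metis (mono_tags, lifting) diff_Suc_1 insertE mem_Collect_eq singletonD)
qed

text \<open>\<open>filled\<close> leaves no coordinate unconstrained. Hence the equalities with
  \<open>t \<ge> 2\<close> count as linear too, and only type 0 can use up the one parallel
  constraint of a variable.\<close>

lemma linear_red:
  assumes "t \<noteq> 0"
  shows "linear_constraint d (sat_vec (rel (t, s, b)) (coords d \<phi> ((i, j), (t, s, b))))"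
proof -
  have "rel (t, s, b) = (=)" using assms by simp
  moreover have "linear_constraint d (sat_vec (=) (coords d \<phi> ((i, j), (t, s, b))))"
  proof (rule linear_sat_vec)
    show "coords d \<phi> ((i, j), (t, s, b)) ! k \<noteq> 0" "coords d \<phi> ((i, j), (t, s, b)) ! k \<le> d" if "k < d" for k
      using assms that by (simp add: Let_def nth_diag filled_def; fail)
        (metis length_coords nth_mem coords_le that)
  qed (rule length_coords)
  ultimately show ?thesis by metis
qed

lemma parallel_red:
  "parallel_constraint d (sat_vec R (coords d \<phi> ((i, j), (0, s, b))))"
  by (rule parallel_sat_vec, rule length_coords) (simp add: Let_def nth_diag)

text \<open>In base \<open>l\<close>, the last two digits of \<open>name l q i j\<close> are
  \<open>i\<close> and \<open>j\<close>, and \<open>q\<close> is what precedes them; division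
  recovers all three.\<close>

lemma name_mod: "j < l \<Longrightarrow> name l q i j mod l = j"
  by (simp add: name_def)

lemma name_div_mod: "j < l \<Longrightarrow> i < l \<Longrightarrow> name l q i j div l mod l = i"
  by (simp add: name_def)

lemma name_div_div: "j < l \<Longrightarrow> i < l \<Longrightarrow> name l q i j div l div l = q"
  by (simp add: name_def)

lemma name_inject:
  assumes "i < l" "j < l" "i' < l" "j' < l"
  shows "name l q i j = name l q' i' j' \<longleftrightarrow> q = q' \<and> i = i' \<and> j = j'"
  using assms by (metis name_mod name_div_mod name_div_div)

lemma name_less:
  assumes "i < l" "j < l" "q < 48"
  shows "name l q i j < 48 * l ^ 2"
proof -
  have "name l q i j div l div l < 48" using assms by (simp add: name_div_div)
  then show ?thesis using assms
    by (simp add: div_mult2_eq[symmetric] power2_eq_square div_less_iff_less_mult)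
qed

lemma slot_less: "s < 3 \<Longrightarrow> slot s b < 6"
  by (auto simp: slot_def)

lemma slot_inject: "slot s b = slot s' b' \<longleftrightarrow> s = s' \<and> b = b'"
  by (cases b; cases b') (auto simp: slot_def, presburger+)

text \<open>The two ends never share \<open>q\<close>: the vectors \<open>z\<close> have
  \<open>q < 6\<close>, the copies 6 to 11, and the others 12 or 13.\<close>

lemma vars_red:
  assumes "c \<in> set (cons_list l)"
  shows "lvar l c < 48 * l ^ 2" "rvar l c < 48 * l ^ 2" "lvar l c \<noteq> rvar l c"
proof -
  obtain i j t s b where c: "c = ((i, j), (t, s, b))" by (metis prod.exhaust)
  with assms have *: "i < l" "j < l" "s < 3" "0 < l" by (auto simp: set_cons_list)
  show "lvar l c < 48 * l ^ 2" "rvar l c < 48 * l ^ 2" "lvar l c \<noteq> rvar l c"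
    using * slot_less[OF *(3), of b] by (auto simp: c name_inject intro!: name_less)
qed

text \<open>A parallel constraint joins the variables with \<open>q = slot s b\<close> and
  \<open>q = 6 + slot s b\<close> of the same \<open>i\<close> and \<open>j\<close>; either end
  determines all of \<open>i\<close>, \<open>j\<close>, \<open>s\<close>, \<open>b\<close>.\<close>

lemma par_unique:
  assumes "((i, j), (0, s, b)) \<in> set (cons_list l)" "((i', j'), (0, s', b')) \<in> set (cons_list l)"
    and "x \<in> {lvar l ((i, j), (0, s, b)), rvar l ((i, j), (0, s, b))}"
    and "x \<in> {lvar l ((i', j'), (0, s', b')), rvar l ((i', j'), (0, s', b'))}"
  shows "((i, j), (0 :: nat, s, b)) = ((i', j'), (0, s', b'))"
  using assms slot_less[of s b] slot_less[of s' b']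
  by (auto simp: set_cons_list name_inject slot_inject)

lemma vector_valued_red: "vector_valued_csp d (red l d \<phi>)"
  unfolding vector_valued_csp_def
proof (intro conjI ballI)
  have mem: "cons_list l ! e \<in> set (cons_list l)" if "e < 72 * l ^ 2" for e
    using that by (simp add: length_cons_list)
  have "finite (carrier_vec d :: gf8 vec set)" by (metis List.finite_set set_gf8_vecs)
  then show "csp_instance (red l d \<phi>)"
    using vars_red[OF mem] by (auto simp: csp_instance_def red_def)
  show "CHAR(gf8) = 2" by (rule CHAR_gf8)
  show "Alph (red l d \<phi>) = carrier_vec d" by (simp add: red_def)
  show "linear_constraint d (Valid (red l d \<phi>) e) \<or> parallel_constraint d (Valid (red l d \<phi>) e)"
    if "e \<in> Cons (red l d \<phi>)" for e
  proof -
    obtain i j t s b where "cons_list l ! e = ((i, j), (t, s, b))" by (metis prod.exhaust)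
    then show ?thesis using linear_red[of t] parallel_red
        by (cases "t = 0") (auto simp: red_def simp del: rel.simps coords.simps)
  qed
  show "card {e \<in> Cons (red l d \<phi>). (lend (red l d \<phi>) e
      = x \<or> rend (red l d \<phi>) e = x) \<and>
      parallel_constraint d (Valid (red l d \<phi>) e) \<and> \<not> linear_constraint d (Valid (red l d \<phi>) e)} \<le> 1"
    (is "card ?E \<le> 1") for x
  proof -
    have "e = e'" if e: "e \<in> ?E" and e': "e' \<in> ?E" for e e'
    proof -
      \<comment> \<open>A constraint that is not linear has type 0, by
        \<open>linear_red\<close>.\<close>
      have par: "\<exists>i j s b. cons_list l ! e = ((i, j), (0, s, b)) \<and> e < 72 * l ^ 2 \<and>
          x \<in> {lvar l ((i, j), (0, s, b)), rvar l ((i, j), (0, s, b))}" if "e \<in> ?E" for e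
      proof -
        obtain i j t s b where c: "cons_list l ! e = ((i, j), (t, s, b))" by (metis prod.exhaust)
        moreover have "t = 0"
          using that linear_red[of t d s b \<phi> i j] c
          by (auto simp: red_def simp del: rel.simps coords.simps)
        ultimately show ?thesis using that by (auto simp: red_def simp del: lvar.simps rvar.simps)
      qed
      obtain i j s b where 1: "cons_list l ! e = ((i, j), (0, s, b))" "e < 72 * l ^ 2"
          "x \<in> {lvar l ((i, j), (0, s, b)), rvar l ((i, j), (0, s, b))}"
        using par[OF e] by blast
      obtain i' j' s' b' where 2: "cons_list l ! e' = ((i', j'), (0, s', b'))" "e' < 72 * l ^ 2"
          "x \<in> {lvar l ((i', j'), (0, s', b')), rvar l ((i', j'), (0, s', b'))}"
        using par[OF e'] by blast
      have "cons_list l ! e = cons_list l ! e'"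
        unfolding 1(1) 2(1)
        by (rule par_unique[OF _ _ 1(3) 2(3)]) (use mem[OF 1(2)] mem[OF 2(2)] 1(1) 2(1) in simp_all)
      then show "e = e'"
        using 1(2) 2(2) by (simp add: nth_eq_iff_index_eq[OF distinct_cons_list] length_cons_list)
    qed
    moreover have "finite ?E" by (simp add: red_def)
    ultimately show ?thesis by (metis (no_types, lifting) card_le_Suc0_iff_eq One_nat_def)
  qed
qed

section \<open>Satisfiability\<close>

definition mk_gf8 :: "(nat \<Rightarrow> bool) \<Rightarrow> gf8" where
  "mk_gf8 f = GF8 (of_bool (f 0)) (of_bool (f 1)) (of_bool (f 2))"

lemma less_3_cases: "s < 3 \<longleftrightarrow> s = 0 \<or> s = 1 \<or> s = (2 :: nat)"
  by auto

lemma gf8_bit_mk: "s < 3 \<Longrightarrow> gf8_bit s (mk_gf8 f) = f s"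
  by (auto simp: less_3_cases mk_gf8_def)

lemma gf8_neq_0: "y \<noteq> 0 \<longleftrightarrow> (\<exists>s<3. gf8_bit s y)"
  by (cases y) (auto simp: zero_gf8_def less_3_cases)

definition holds :: "(nat \<Rightarrow> bool) \<Rightarrow> clause \<Rightarrow> nat \<Rightarrow> bool" where
  "holds \<alpha> c s \<longleftrightarrow> \<alpha> (fst (c ! s)) = snd (c ! s)"

definition var_vec :: "nat \<Rightarrow> (nat \<Rightarrow> bool) \<Rightarrow> nat \<Rightarrow> gf8 vec" where
  "var_vec d \<alpha> j = vec d (\<lambda>p. of_bool (\<alpha> (j * d + p)))"

text \<open>Coordinates past the end of \<open>\<phi>\<close> have unspecified values. Type 0
  constraints skip them, and the copies carry the same vector.\<close>

definition clause_vec :: "nat \<Rightarrow> cnf \<Rightarrow> (nat \<Rightarrow> bool) \<Rightarrow> nat \<Rightarrow> gf8 vec" where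
  "clause_vec d \<phi> \<alpha> i = vec d (\<lambda>k. mk_gf8 (holds \<alpha> (\<phi> ! (i * d + k))))"

text \<open>An entry 0 gives index \<open>0 - 1 = 0\<close>, the coordinate to which
  \<open>filled\<close> ties it.\<close>

definition lit_vec :: "nat \<Rightarrow> cnf \<Rightarrow> (nat \<Rightarrow> bool) \<Rightarrow> nat \<Rightarrow> nat \<Rightarrow> nat \<Rightarrow> bool \<Rightarrow> gf8 vec" where
  "lit_vec d \<phi> \<alpha> i j s b =
     vec d (\<lambda>k. var_vec d \<alpha> j $ (locs d (drop (i * d) \<phi>) (j * d) d s b ! k - 1))"

text \<open>The values \<open>q div 2\<close> and \<open>odd q\<close> invert \<open>slot\<close>.
  The last case serves the clause vectors, their copies and the idle variables.\<close>

definition assignment :: "nat \<Rightarrow> nat \<Rightarrow> cnf \<Rightarrow> (nat \<Rightarrow> bool) \<Rightarrow> nat \<Rightarrow> gf8 vec" where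
  "assignment l d \<phi> \<alpha> x = (let q = x div l div l; i = x div l mod l; j = x mod l in
     if q < 6 then lit_vec d \<phi> \<alpha> i j (q div 2) (odd q)
     else if q = 12 then var_vec d \<alpha> j else clause_vec d \<phi> \<alpha> i)"

lemma assignment_carrier: "assignment l d \<phi> \<alpha> x \<in> carrier_vec d"
  by (simp add: assignment_def Let_def lit_vec_def var_vec_def clause_vec_def)

lemma assignment_name:
  assumes "i < l" "j < l"
  shows "assignment l d \<phi> \<alpha> (name l q i j) =
    (if q < 6 then lit_vec d \<phi> \<alpha> i j (q div 2) (odd q)
     else if q = 12 then var_vec d \<alpha> j else clause_vec d \<phi> \<alpha> i)"
  using assms by (simp add: assignment_def name_mod name_div_mod name_div_div)

lemma slot_div: "slot s b div 2 = s" "odd (slot s b) = b"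
  by (auto simp: slot_def)

lemma locs_neq_0D:
  assumes "k < d" "locs d (drop (i * d) \<phi>) a d s b ! k \<noteq> 0"
  shows "i * d + k < length \<phi> \<and> snd (\<phi> ! (i * d + k) ! s) = b \<and> a
      \<le> fst (\<phi> ! (i * d + k) ! s) \<and>
    fst (\<phi> ! (i * d + k) ! s) - a < d \<and>
    locs d (drop (i * d) \<phi>) a d s b ! k = Suc (fst (\<phi> ! (i * d + k) ! s) - a)"
  using assms by (auto simp: nth_locs entry_def pos_def split: if_splits)

lemma red_complete:
  assumes \<phi>: "\<And>c. c \<in> set \<phi> \<Longrightarrow> length c = 3"
    and \<alpha>: "\<And>c. c \<in> set \<phi>
        \<Longrightarrow> \<exists>(x, s)\<in>set c. \<alpha> x = s"
  shows "csp_satisfiable (red l d \<phi>)"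
  unfolding csp_satisfiable_def
proof (intro exI conjI ballI)
  let ?\<sigma> = "assignment l d \<phi> \<alpha>"
  show "?\<sigma> v \<in> Alph (red l d \<phi>)" for v
    by (simp add: red_def assignment_carrier)
  fix e assume "e \<in> Cons (red l d \<phi>)"
  then have e: "cons_list l ! e \<in> set (cons_list l)" by (simp add: red_def length_cons_list)
  obtain i j t s b where c: "cons_list l ! e = ((i, j), (t, s, b))" by (metis prod.exhaust)
  have *: "i < l" "j < l" "s < 3" using e by (auto simp: c set_cons_list)
  note slot = slot_less[OF *(3), of b]
  let ?L = "locs d (drop (i * d) \<phi>) (j * d) d s b"
  have Z: "?\<sigma> (name l (slot s b) i j) = lit_vec d \<phi> \<alpha> i j s b"
    using * slot by (simp add: assignment_name slot_div)
  have Y: "?\<sigma> (name l (6 + slot s b) i j) = clause_vec d \<phi> \<alpha> i"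
    using * slot by (simp add: assignment_name)
  have "sat_vec (rel (t, s, b)) (coords d \<phi> ((i, j), (t, s, b)))
    (?\<sigma> (lvar l ((i, j), (t, s, b)))) (?\<sigma> (rvar l ((i, j), (t, s, b))))"
  proof -
    consider "t = 0" | "t = 1" | "t \<ge> 2" by linarith
    then show ?thesis
    proof cases
      case 1
      have "lit_rel s b (clause_vec d \<phi> \<alpha> i $ k) (lit_vec d \<phi> \<alpha> i j s b $ k)"
        if k: "k < d" and L: "?L ! k \<noteq> 0" for k
      proof -
        define c where "c = \<phi> ! (i * d + k)"
        from locs_neq_0D[OF k L] have L': "i * d + k < length \<phi>" "snd (c ! s) = b"
            "j * d \<le> fst (c ! s)" "fst (c ! s) - j * d < d" "?L ! k = Suc (fst (c ! s) - j * d)"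
          by (auto simp: c_def)
        then have "c \<in> set \<phi>" by (simp add: c_def)
        from \<phi>[OF this] \<alpha>[OF this] obtain r where "r < 3" "holds \<alpha> c r"
          by (auto simp: holds_def in_set_conv_nth)
        then have "mk_gf8 (holds \<alpha> c) \<noteq> 0" by (auto simp: gf8_neq_0 gf8_bit_mk)
        \<comment> \<open>The entry of \<open>?L\<close> points at coordinate
          \<open>x - j * d\<close> of block \<open>j\<close> for the literal's variable
          \<open>x\<close>, where \<open>var_vec\<close> stores the value of \<open>x\<close>
          because \<open>j * d \<le> x\<close>.\<close>
        then show ?thesis
          using k L' *(3)
          by (auto simp: lit_rel_def clause_vec_def lit_vec_def var_vec_def gf8_bit_mk c_def[symmetric] holds_def)
      qed
      then show ?thesis
        using 1 Z Y by (auto simp: sat_vec_def Let_def nth_diag)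
    next
      case 2
      then show ?thesis
        using * Z by (auto simp: sat_vec_def filled_def assignment_name lit_vec_def)
    next
      case 3
      then show ?thesis
        using * Y by (auto simp: sat_vec_def Let_def nth_diag assignment_name)
    qed
  qed
  then show "Valid (red l d \<phi>) e (?\<sigma> (lend (red l d \<phi>) e)) (?\<sigma> (rend (red l d \<phi>) e))"
    by (simp add: red_def c del: rel.simps coords.simps lvar.simps rvar.simps)
qed

lemma satD: "sat_vec R es u v \<Longrightarrow> k < length es
    \<Longrightarrow> es ! k = Suc p \<Longrightarrow> R (u $ k) (v $ p)"
  by (auto simp: sat_vec_def)

lemma red_sound:
  assumes \<phi>: "\<And>c. c \<in> set \<phi>
      \<Longrightarrow> length c = 3 \<and> clause_vars c \<subseteq> {..<n}"
    and len: "length \<phi> \<le> l * d" "n \<le> l * d"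
    and sat: "csp_satisfiable (red l d \<phi>)"
  shows "cnf_satisfiable \<phi>"
proof -
  obtain \<sigma> where \<sigma>: "\<And>e. e < 72 * l ^ 2
      \<Longrightarrow> sat_vec (rel (snd (cons_list l ! e)))
      (coords d \<phi> (cons_list l ! e)) (\<sigma> (lvar l (cons_list l ! e))) (\<sigma> (rvar l (cons_list l ! e)))"
    and carr: "\<And>x. x < 48 * l ^ 2 \<Longrightarrow> \<sigma> x \<in> carrier_vec d"
    using sat unfolding csp_satisfiable_def red_def by auto
  have con: "sat_vec (rel (t, s, b)) (coords d \<phi> ((i, j), (t, s, b)))
      (\<sigma> (lvar l ((i, j), (t, s, b)))) (\<sigma> (rvar l ((i, j), (t, s, b))))"
    if ij: "i < l" "j < l" "s < 3" "t < 12" for i j t s b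
  proof -
    have "((i, j), (t, s, b)) \<in> set (cons_list l)" using ij by (simp add: set_cons_list)
    then obtain e where "e < 72 * l ^ 2" "cons_list l ! e = ((i, j), (t, s, b))"
      by (metis in_set_conv_nth length_cons_list)
    with \<sigma>[of e] show ?thesis by (simp del: rel.simps coords.simps lvar.simps rvar.simps)
  qed
  define X where "X j = \<sigma> (name l 12 0 j)" for j
  define Y where "Y i = \<sigma> (name l 13 i 0)" for i
  \<comment> \<open>The vectors \<open>X j\<close> may hold any field elements, so every nonzero one
    is read as true.\<close>
  define \<alpha> where "\<alpha> x \<longleftrightarrow> X (x div d) $ (x mod d) \<noteq> 0" for x
  have "\<exists>(x, s)\<in>set c. \<alpha> x = s" if c: "c \<in> set \<phi>" for c
  proof -
    obtain h where h: "h < length \<phi>" "c = \<phi> ! h" using c by (metis in_set_conv_nth)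
    define i k where "i = h div d" and "k = h mod d"
    \<comment> \<open>A clause exists, so \<open>length \<phi> \<le> l * d\<close> rules out
      \<open>d = 0\<close>.\<close>
    have "0 < d" using h(1) len(1) by (cases d) auto
    then have k: "k < d" and hk: "i * d + k = h" by (auto simp: i_def k_def)
    have i: "i < l" using h(1) len(1) by (simp add: i_def less_mult_imp_div_less)
    let ?y = "Y i $ k"
    have y: "?y \<noteq> 0 \<and> (gf8_bit s ?y \<longleftrightarrow> \<alpha> (fst (c ! s))
        = snd (c ! s))" if s: "s < 3" for s
    proof -
      define x b where "x = fst (c ! s)" and "b = snd (c ! s)"
      define j where "j = x div d"
      have "c ! s \<in> set c" using \<phi>[OF c] s by simp
      then have "x < n" using \<phi>[OF c] by (auto simp: x_def clause_vars_def)
      then have j: "j < l" using len(2) by (simp add: j_def less_mult_imp_div_less)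
      let ?L = "locs d (drop (i * d) \<phi>) (j * d) d s b"
      have "x - j * d = x mod d" "j * d \<le> x"
        unfolding j_def by (simp_all add: minus_div_mult_eq_mod)
      then have L: "?L ! k = Suc (x mod d)"
        using k hk h s \<phi>[OF c] \<open>0 < d\<close>
        by (simp add: nth_locs entry_def pos_def x_def b_def)
      note slot = slot_less[OF s, of b]
      \<comment> \<open>Types 2, 1 and 0 are used in turn: the copy agrees with \<open>Y i\<close>,
        \<open>z\<close> reads the variable from \<open>X j\<close>, and the parallel constraint
        compares the two.\<close>
      have d: "\<sigma> (name l (6 + slot s b) i j) $ k = ?y"
        using satD[OF con[OF i j s, of 2 b], of k k] k by (simp add: Let_def nth_diag filled_def Y_def)
      have z: "\<sigma> (name l (slot s b) i j) $ k = X j $ (x mod d)"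
        using satD[OF con[OF i j s, of 1 b], of k "x mod d"] k L by (simp add: Let_def filled_def X_def)
      have "lit_rel s b ?y (X j $ (x mod d))"
        using satD[OF con[OF i j s, of 0 b], of k k] k L d z by (simp add: Let_def nth_diag)
      then show ?thesis by (simp add: lit_rel_def \<alpha>_def x_def b_def j_def)
    qed
    \<comment> \<open>\<open>y\<close> at \<open>s = 0\<close> yields \<open>?y \<noteq> 0\<close>,
      so some bit is set, and \<open>y\<close> at that position makes the literal true.\<close>
    then obtain s where "s < 3" "gf8_bit s ?y" using gf8_neq_0 by (metis zero_less_numeral)
    with y have "s < length c" "\<alpha> (fst (c ! s)) = snd (c ! s)" using \<phi>[OF c] by auto
    then show ?thesis by (intro bexI[of _ "c ! s"]) (auto simp: case_prod_beta)
  qed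
  then show ?thesis unfolding cnf_satisfiable_def by blast
qed

section \<open>The time bound\<close>

lemma le_mult_cdiv: "0 < l \<Longrightarrow> n \<le> l * cdiv n l"
proof (induction n l rule: cdiv.induct)
  case (1 n l)
  show ?case
  proof (cases "n = 0")
    case False
    with 1 have "n - l \<le> l * cdiv (n - l) l" by simp
    moreover have "cdiv n l = Suc (cdiv (n - l) l)" using False 1(2) by (subst cdiv.simps) simp
    ultimately show ?thesis by simp
  qed simp
qed

lemma cdiv_eq_ceiling: "0 < l \<Longrightarrow> cdiv n l = nat \<lceil>real n / real l\<rceil>"
proof (induction n l rule: cdiv.induct)
  case (1 n l)
  show ?case
  proof (cases "n = 0")
    case False
    show ?thesis
    proof (cases "n \<le> l")
      case True
      have "\<lceil>real n / real l\<rceil> = 1" using True False 1(2) by (simp add: ceiling_eq_iff)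
      then show ?thesis using True False 1(2) by (simp add: cdiv.simps[of n] cdiv.simps[of 0])
    next
      case False
      then have "real n / real l = real (n - l) / real l + 1" using 1(2) by (simp add: field_simps)
      then have "\<lceil>real n / real l\<rceil> = \<lceil>real (n - l) / real l\<rceil> + 1" by simp
      \<comment> \<open>Nonnegativity lets \<open>nat\<close> distribute over the added 1.\<close>
      moreover have "0 \<le> \<lceil>real (n - l) / real l\<rceil>"
          by (simp add: ceiling_le_zero order_trans[of _ 0] zero_le_ceiling less_le_trans[of "-1" 0])
      moreover have "cdiv n l = Suc (cdiv (n - l) l)" using False 1(2) by (subst cdiv.simps) simp
      ultimately show ?thesis using 1 \<open>n \<noteq> 0\<close> by (simp add: nat_add_distrib)
    qed
  qed (simp add: cdiv.simps)
qed

text \<open>Every clause contains a variable and each variable lies in at most four clauses: a union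
  bound over the variables.\<close>

lemma length_bounded_3cnf:
  assumes "bounded_3cnf n \<phi>"
  shows "length \<phi> \<le> 4 * n"
proof -
  let ?A = "\<lambda>x. {j. j < length \<phi> \<and> x \<in> clause_vars (\<phi> ! j)}"
  have "\<exists>x<n. x \<in> clause_vars (\<phi> ! j)" if "j < length \<phi>" for j
  proof -
    have "card (clause_vars (\<phi> ! j)) = 3" "clause_vars (\<phi> ! j) \<subseteq> {..<n}"
      using assms nth_mem[OF that] by (auto simp: bounded_3cnf_def)
    then show ?thesis by (metis card.empty ex_in_conv lessThan_iff subsetD zero_neq_numeral)
  qed
  then have "{..<length \<phi>} \<subseteq> (\<Union>x<n. ?A x)" by auto
  then have "length \<phi> \<le> card (\<Union>x<n. ?A x)"
    using card_mono[of "\<Union>x<n. ?A x" "{..<length \<phi>}"] by simp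
  also have "\<dots> \<le> (\<Sum>x<n. card (?A x))" by (rule card_UN_le) simp
  also have "\<dots> \<le> (\<Sum>x<n. 4)" by (rule sum_mono)
      (use assms in \<open>auto simp: bounded_3cnf_def\<close>)
  finally show ?thesis by simp
qed

lemma block_size_bound:
  assumes "0 < l" "m \<le> 4 * n"
  shows "real (block_size l m n) \<le> 4 * (real n / real l) + 1"
proof -
  have "real (nat \<lceil>x\<rceil>) \<le> x + 1" if "0 \<le> x" for x :: real using that by linarith
  from this[of "real m / real l"] this[of "real n / real l"]
  have "real (cdiv m l) \<le> real m / real l + 1" "real (cdiv n l) \<le> real n / real l + 1"
    using assms(1) by (simp_all add: cdiv_eq_ceiling)
  moreover have "real m / real l \<le> 4 * (real n / real l)"
    using assms by (simp add: divide_right_mono)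
  moreover have "real n / real l \<le> 4 * (real n / real l)" by (simp add: divide_right_mono)
  ultimately show ?thesis unfolding block_size_def of_nat_max by linarith
qed

text \<open>With \<open>P = 2 powr (12 * (n / l))\<close> and each summand measured in units of
  \<open>l * P\<close>, the factor is 14 = 1 + 1 + 4 + 8. The exponent is \<open>12 = 3 * 4\<close>,
  from \<open>8 = 2 ^ 3\<close> and \<open>block_size_bound\<close>, whose added 1 gives the factor
  8.\<close>

lemma size_bound:
  assumes "0 < l" "m \<le> 4 * n"
  shows "real (l + n + m + 8 ^ block_size l m n) \<le> 14 * (real l * 2 powr (12 * (real n / real l)))"
proof -
  define r where "r = real n / real l"
  have r: "0 \<le> r" "real n = real l * r" using assms(1) by (auto simp: r_def)
  define P where "P = 2 powr (12 * r)"
  \<comment> \<open>Absorbs the polynomial factor \<open>n / l\<close> into the exponential, so that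
    \<open>n = l * r\<close> is at most \<open>l * P\<close>.\<close>
  have rP: "r \<le> P"
  proof -
    have "1 / 12 \<le> ln (2 :: real)" using ln_le_minus_one[of "1 / 2"] by (simp add: ln_div)
    then have "r \<le> 12 * r * ln 2" using r mult_left_mono[of "1 / 12" "ln 2" "12 * r"] by simp
    also have "\<dots> \<le> exp (12 * r * ln 2)"
        using exp_ge_add_one_self[of "12 * r * ln 2"] by linarith
    also have "\<dots> = P" by (simp add: P_def powr_def)
    finally show ?thesis .
  qed
  have P: "1 \<le> P" using r by (simp add: P_def ge_one_powr_ge_zero)
  have n: "real n \<le> real l * P" using r rP by (simp add: mult_left_mono)
  have l: "1 \<le> real l" using assms(1) by simp
  then have lP: "real l \<le> real l * P" "P \<le> real l * P" using P
      by (simp_all add: mult_le_cancel_left1)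
  have m: "real m \<le> 4 * (real l * P)" using n assms(2) by linarith
  have "8 ^ block_size l m n = (2 :: real) powr (3 * real (block_size l m n))"
    by (simp add: powr_realpow[symmetric] powr_powr[symmetric])
  also have "\<dots> \<le> 2 powr (12 * r + 3)" using block_size_bound[OF assms] by (simp add: r_def)
  also have "\<dots> = 8 * P" by (simp add: P_def powr_add)
  finally have "8 ^ block_size l m n \<le> 8 * (real l * P)" using lP by linarith
  with n l m lP have "real l + real n + real m + 8 ^ block_size l m n
      \<le> 14 * (real l * P)" by linarith
  then show ?thesis by (simp add: P_def r_def)
qed

theorem theorem3p4:
  shows "\<exists>(P :: program) (C :: real) (a :: nat) (b :: real).
    \<forall>(l :: nat) (n :: nat) (m :: nat) (\<phi> :: cnf).
      0 < l \<and> bounded_3cnf n \<phi> \<and> m = length \<phi> \<longrightarrow>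
      (\<exists>(G :: (nat, nat, gf8 vec) csp) (d :: nat) (y :: tree) (t :: nat).
         runs_on P (enc_input l n \<phi>) y t \<and>
         describes_csp d y G \<and>
         vector_valued_csp d G \<and>
         card (Vars G) = 48 * l ^ 2 \<and> card (Cons G) = 72 * l ^ 2 \<and>
         real t \<le> C * real l ^ a * 2 powr (b * (real n / real l)) \<and>
         Alph G = carrier_vec d \<and>
         d = max (nat \<lceil>real m / real l\<rceil>) (nat \<lceil>real n / real l\<rceil>) \<and>
         (csp_satisfiable G \<longleftrightarrow> cnf_satisfiable \<phi>))"
\<comment> \<open>The running time is of order \<open>S ^ 6\<close>, and \<open>S\<close> is at most
  \<open>14 * l * 2 powr (12 * (n / l))\<close>; the sixth power gives \<open>14 ^ 6\<close>,
  \<open>l ^ 6\<close> and \<open>72 = 6 * 12\<close>.\<close>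
proof (rule exI[of _ prog], rule exI[of _ "40000 * real (call_cost prog) * 14 ^ 6"],
    rule exI[of _ 6], rule exI[of _ 72], intro allI impI)
  fix l n m :: nat and \<phi> :: cnf
  assume "0 < l \<and> bounded_3cnf n \<phi> \<and> m = length \<phi>"
  then have l: "0 < l" and \<phi>: "bounded_3cnf n \<phi>" and m: "m = length \<phi>" by auto
  let ?d = "block_size l m n"
  \<comment> \<open>One number above \<open>l\<close>, \<open>n\<close>, \<open>m\<close>, all
    variable indices and the number \<open>8 ^ ?d\<close> of vectors.\<close>
  define S where "S = l + n + m + 8 ^ ?d"
  have clauses: "length c = 3 \<and> clause_vars c \<subseteq> {..<n}" if "c \<in> set \<phi>" for c
    using \<phi> that by (auto simp: bounded_3cnf_def)
  have "fst p \<le> S" if "c \<in> set \<phi>" "p \<in> set c" for c p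
    using clauses[OF that(1)] that(2) by (auto simp: clause_vars_def S_def)
  then obtain t where t: "runs_on prog (enc_input l n \<phi>) (enc_out l ?d \<phi>) t"
      "t \<le> 40000 * call_cost prog * S ^ 6"
    using runs_on_prog[of \<phi> S l n] l by (auto simp: S_def m)
  have "real t \<le> real (40000 * call_cost prog * S ^ 6)" using t(2) by (rule of_nat_mono)
  also have "\<dots> = 40000 * real (call_cost prog) * real S ^ 6" by simp
  also have "\<dots> \<le> 40000 * real (call_cost prog) * (14 * (real l * 2 powr (12 * (real n / real l)))) ^ 6"
    using size_bound[OF l, of m n] length_bounded_3cnf[OF \<phi>]
    by (intro mult_left_mono power_mono) (simp_all add: S_def m)
  also have "\<dots> = 40000 * real (call_cost prog) * 14 ^ 6 * real l ^ 6 * 2 powr (72 * (real n / real l))"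
    by (simp add: power_mult_distrib powr_power)
  finally have time: "real t \<le> 40000 * real (call_cost prog) * 14 ^ 6 * real l ^ 6 * 2 powr (72 * (real n / real l))" .
  have "m \<le> l * ?d" "n \<le> l * ?d"
    using le_mult_cdiv[OF l, of m] le_mult_cdiv[OF l, of n]
    by (auto simp: block_size_def intro: order_trans[OF _ mult_le_mono2])
  then have sound: "cnf_satisfiable \<phi>" if "csp_satisfiable (red l ?d \<phi>)"
    using red_sound[OF clauses, of \<phi> l ?d] that m by blast
  have complete: "csp_satisfiable (red l ?d \<phi>)" if "cnf_satisfiable \<phi>"
  proof -
    from that obtain \<alpha> where "\<forall>c\<in>set \<phi>. \<exists>(x, s)\<in>set c. \<alpha> x
        = s" unfolding cnf_satisfiable_def by blast
    then show ?thesis using clauses by (intro red_complete[where \<alpha> = \<alpha>]) auto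
  qed
  have "csp_satisfiable (red l ?d \<phi>) \<longleftrightarrow> cnf_satisfiable \<phi>"
    using sound complete by (rule iffI)
  moreover have "?d = max (nat \<lceil>real m / real l\<rceil>) (nat \<lceil>real n / real l\<rceil>)"
    by (simp add: block_size_def cdiv_eq_ceiling[OF l])
  moreover have "card (Vars (red l ?d \<phi>)) = 48 * l ^ 2" "card (Cons (red l ?d \<phi>)) = 72 * l ^ 2"
      "Alph (red l ?d \<phi>) = carrier_vec ?d"
    by (simp_all add: red_def)
  moreover note t(1) time
  ultimately show "\<exists>G d y t. runs_on prog (enc_input l n \<phi>) y t \<and>
         describes_csp d y G \<and> vector_valued_csp d G \<and>
         card (Vars G) = 48 * l ^ 2 \<and> card (Cons G) = 72 * l ^ 2 \<and>
         real t \<le> 40000 * real (call_cost prog) * 14 ^ 6 * real l ^ 6 * 2 powr (72 * (real n / real l)) \<and>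
         Alph G = carrier_vec d \<and>
         d = max (nat \<lceil>real m / real l\<rceil>) (nat \<lceil>real n / real l\<rceil>) \<and>
         (csp_satisfiable G \<longleftrightarrow> cnf_satisfiable \<phi>)"
    using describes_red[of ?d l \<phi>] vector_valued_red[of ?d l \<phi>]
    by - (rule exI[of _ "red l ?d \<phi>"], rule exI[of _ ?d], rule exI[of _ "enc_out l ?d \<phi>"],
      rule exI[of _ t], intro conjI; assumption)
qed

end
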